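(* Let $1<q<\infty$ with conjugate exponent $q'$ ($1/q+1/q'=1$), let $(\Omega,\mu)$ be a $\sigma$-finite measure space and let $a\colon\Omega\to\mathbb{C}$ be measurable such that $\operatorname{Re}a$ is essentially bounded from above. Let $M_a$ be the corresponding multiplication operator on $X=L^q(\Omega,\mu)$ and $T$ the $C_0$-semigroup generated by it, $T(t)f=e^{ta}f$. Then $b\in\mathcal{L}(\mathbb{C},X_{-1})\simeq X_{-1}$ is (infinite-time) $L^{q'}$-admissible for $T$ if and only if the Laplace transform induces a bounded map $$\mathscr{L}\colon L^{q'}([0,\infty))\to L^q(\mathbb{C},\nu),\qquad (\mathscr{L}u)(z)=\int_0^\infty e^{-tz}u(t)\,dt,$$ where $\nu=(-a)_*\big(|b|^q\mu\big)$ is the push-forward under $-a$ of the measure with density $|b|^q$ with respect to $\mu$.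
   Context: The multiplication operator is $M_ag=ag$ with domain $\{g\in L^q(\Omega,\mu):ag\in L^q(\Omega,\mu)\}$. $X_{-1}$ is the completion of $X$ with respect to $\|x\|_{X_{-1}}=\|(rI-M_a)^{-1}x\|_X$ for a fixed $r\in\rho(M_a)$; concretely it is the weighted space $L^q(\Omega,|r-a|^{-q}\mu)$ of measurable functions on $\Omega$ (with $r=0$ allowed if $0\in\rho(M_a)$). $T$ extends to $X_{-1}$ by the same formula. An element $b\in X_{-1}$ is identified with the operator $\mathbb{C}\to X_{-1}$, $z\mapsto zb$. For $1\le p\le\infty$, $b$ is infinite-time $L^p$-admissible for $T$ if for every $t\ge0$ and $u\in L^p([0,t])$ the integral $\int_0^tT(t-s)bu(s)\,ds$ lies in $X$ and there is a constant $C>0$, independent of $t$, with $\|\int_0^tT(t-s)bu(s)\,ds\|_X\le C\|u\|_{L^p([0,t])}$ for all such $t,u$. Boundedness of $\mathscr{L}$ is understood as: there is $C>0$ such that $\|\mathscr{L}u\|_{L^q(\mathbb{C},\nu)}\le C\|u\|_{L^{q'}([0,\infty))}$ for all compactly supported $u\in L^{q'}([0,\infty))$ (for which $\mathscr{L}u$ is an entire function). *)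

theory Defs
  imports "HOL-Analysis.Analysis"
begin

text \<open>
  Elements of $L^p$ are handled through representatives: a function stands for its class
  modulo almost-everywhere equality, and identities between elements are stated as \<open>AE\<close>.
\<close>

definition Lp_space :: "real \<Rightarrow> 'a measure \<Rightarrow> ('a \<Rightarrow> complex) set" where
  "Lp_space p M = {f \<in> borel_measurable M. integrable M (\<lambda>x. norm (f x) powr p)}"

definition Lp_norm :: "real \<Rightarrow> 'a measure \<Rightarrow> ('a \<Rightarrow> complex) \<Rightarrow> real" where
  "Lp_norm p M f = (LINT x|M. norm (f x) powr p) powr (1 / p)"

text \<open>
  The Bochner integral of a function on \<open>K\<close> with values in the Banach space $L^p(N)$.
  The library integral needs a separable Banach space type as codomain and hence does not apply;
  this is the usual definition, by simple functions converging almost everywhere in norm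
  and in mean.
\<close>

definition simple_Lp_integrable ::
  "real \<Rightarrow> 'a measure \<Rightarrow> 's measure \<Rightarrow> ('s \<Rightarrow> 'a \<Rightarrow> complex) \<Rightarrow> bool" where
  "simple_Lp_integrable p N K S \<longleftrightarrow>
     simple_function K S \<and> S ` space K \<subseteq> Lp_space p N \<and>
     emeasure K {s \<in> space K. S s \<noteq> (\<lambda>_. 0)} \<noteq> \<infinity>"

definition simple_Lp_integral ::
  "'s measure \<Rightarrow> ('s \<Rightarrow> 'a \<Rightarrow> complex) \<Rightarrow> 'a \<Rightarrow> complex" where
  "simple_Lp_integral K S =
     (\<lambda>\<omega>. \<Sum>y\<in>S ` space K. complex_of_real (measure K {s \<in> space K. S s = y}) * y \<omega>)"

definition has_Lp_bochner_integral ::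
  "real \<Rightarrow> 'a measure \<Rightarrow> 's measure \<Rightarrow> ('s \<Rightarrow> 'a \<Rightarrow> complex) \<Rightarrow> ('a \<Rightarrow> complex) \<Rightarrow> bool" where
  "has_Lp_bochner_integral p N K F x \<longleftrightarrow>
     x \<in> Lp_space p N \<and> (\<forall>s\<in>space K. F s \<in> Lp_space p N) \<and>
     (\<exists>S. (\<forall>n::nat. simple_Lp_integrable p N K (S n)) \<and>
          (AE s in K. (\<lambda>n. Lp_norm p N (\<lambda>\<omega>. F s \<omega> - S n s \<omega>)) \<longlonglongrightarrow> 0) \<and>
          (\<lambda>n. \<integral>\<^sup>+ s. ennreal (Lp_norm p N (\<lambda>\<omega>. F s \<omega> - S n s \<omega>)) \<partial>K) \<longlonglongrightarrow> 0 \<and>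
          (\<lambda>n. Lp_norm p N (\<lambda>\<omega>. simple_Lp_integral K (S n) \<omega> - x \<omega>)) \<longlonglongrightarrow> 0)"

definition mult_op :: "('a \<Rightarrow> complex) \<Rightarrow> ('a \<Rightarrow> complex) \<Rightarrow> 'a \<Rightarrow> complex" where
  "mult_op a g = (\<lambda>\<omega>. a \<omega> * g \<omega>)"

definition mult_op_dom :: "real \<Rightarrow> 'a measure \<Rightarrow> ('a \<Rightarrow> complex) \<Rightarrow> ('a \<Rightarrow> complex) set" where
  "mult_op_dom q M a = {g \<in> Lp_space q M. mult_op a g \<in> Lp_space q M}"

text \<open>
  The resolvent set of the multiplication operator: $rI - M_a$ is a bijection from its domain
  onto $L^q$ (uniqueness being modulo null sets) with bounded inverse.
\<close>

definition mult_op_resolvent_set :: "real \<Rightarrow> 'a measure \<Rightarrow> ('a \<Rightarrow> complex) \<Rightarrow> complex set" where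
  "mult_op_resolvent_set q M a =
     {r. \<exists>C. \<forall>f\<in>Lp_space q M.
           \<exists>g\<in>mult_op_dom q M a.
             (AE \<omega> in M. r * g \<omega> - mult_op a g \<omega> = f \<omega>) \<and>
             (\<forall>h\<in>mult_op_dom q M a.
                (AE \<omega> in M. r * h \<omega> - mult_op a h \<omega> = f \<omega>) \<longrightarrow> (AE \<omega> in M. h \<omega> = g \<omega>)) \<and>
             Lp_norm q M g \<le> C * Lp_norm q M f}"

definition mult_semigroup :: "('a \<Rightarrow> complex) \<Rightarrow> real \<Rightarrow> ('a \<Rightarrow> complex) \<Rightarrow> 'a \<Rightarrow> complex" where
  "mult_semigroup a t f = (\<lambda>\<omega>. exp (complex_of_real t * a \<omega>) * f \<omega>)"

text \<open>
  The extrapolation space $X_{-1}$ is $L^q$ over the weighted measure $|r - a|^{-q}\mu$.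
  For \<open>r\<close> in the resolvent set, $r = a$ only on a null set (where \<open>powr\<close> yields weight 0), so
  this measure has the same null sets as $\mu$.
\<close>

definition extrapolation_measure ::
  "real \<Rightarrow> 'a measure \<Rightarrow> ('a \<Rightarrow> complex) \<Rightarrow> complex \<Rightarrow> 'a measure" where
  "extrapolation_measure q M a r = density M (\<lambda>\<omega>. ennreal (norm (r - a \<omega>) powr (- q)))"

definition extrapolation_space ::
  "real \<Rightarrow> 'a measure \<Rightarrow> ('a \<Rightarrow> complex) \<Rightarrow> complex \<Rightarrow> ('a \<Rightarrow> complex) set" where
  "extrapolation_space q M a r = Lp_space q (extrapolation_measure q M a r)"

text \<open>
  Infinite-time $L^p$-admissibility, for finite \<open>p\<close>. The convolution is a Bochner integral in
  $X_{-1}$, and that it lies in $X$ means that its value \<open>x\<close>, unique up to null sets, is in $L^q(\mu)$.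
\<close>

definition infinite_time_admissible ::
  "real \<Rightarrow> real \<Rightarrow> 'a measure \<Rightarrow> ('a \<Rightarrow> complex) \<Rightarrow> complex \<Rightarrow> ('a \<Rightarrow> complex) \<Rightarrow> bool" where
  "infinite_time_admissible p q M a r b \<longleftrightarrow>
     (\<exists>C>0. \<forall>t\<ge>0. \<forall>u\<in>Lp_space p (restrict_space lborel {0..t}).
        \<exists>x. has_Lp_bochner_integral q (extrapolation_measure q M a r)
              (restrict_space lborel {0..t})
              (\<lambda>s \<omega>. mult_semigroup a (t - s) b \<omega> * u s) x \<and>
            x \<in> Lp_space q M \<and>
            Lp_norm q M x \<le> C * Lp_norm p (restrict_space lborel {0..t}) u)"

definition laplace :: "(real \<Rightarrow> complex) \<Rightarrow> complex \<Rightarrow> complex" where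
  "laplace u z = (LINT t:{0..}|lborel. exp (- (complex_of_real t * z)) * u t)"

definition laplace_bounded :: "real \<Rightarrow> real \<Rightarrow> complex measure \<Rightarrow> bool" where
  "laplace_bounded p q \<nu> \<longleftrightarrow>
     (\<exists>C>0. \<forall>u\<in>Lp_space p (restrict_space lborel {0..}).
        (\<exists>R. AE t in restrict_space lborel {0..}. R < t \<longrightarrow> u t = 0) \<longrightarrow>
        laplace u \<in> Lp_space q \<nu> \<and>
        Lp_norm q \<nu> (laplace u) \<le> C * Lp_norm p (restrict_space lborel {0..}) u)"

end

theory Submission
  imports Defs
begin

text \<open>
  The convolution $\int_0^t T(t-s) b u(s)\,ds$, taken as a Bochner integral in $X_{-1}$, agrees almost
  everywhere with the pointwise integral $b(\omega) \int_0^t e^{(t-s)a(\omega)} u(s)\,ds$. With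
  $v(s) = u(t-s)$ on $[0,t]$ and $v = 0$ beyond, the latter is $b \cdot (\mathcal{L}v)(-a)$, whose
  $L^q(\mu)$-norm is the $L^q(\nu)$-norm of $\mathcal{L}v$. As $u$ and $v$ have the same norm and
  every compactly supported $v$ arises in this way, the two estimates are the same.
\<close>

text \<open>The Bochner integral is given only through approximating step functions, so its
  agreement with the pointwise integral has two sides. Admissibility supplies some value
  \<open>x\<close>, which must be recognised as the pointwise integral. Boundedness of the transform
  only estimates the pointwise integral, which must then be shown to be a Bochner integral at all,
  and this requires explicit step functions. Since \<open>a\<close> may be unbounded, the semigroup
  need not be continuous in operator norm; the bound Re a \<le> c provides the domination that gives
  convergence along the single orbit of \<open>b\<close>. Both sides are almost-everywhere
  statements for the weighted measure, while the two estimates concern \<open>M\<close>; the passage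
  between them rests on r - a vanishing only on a null set.\<close>

section \<open>Elementary estimates for \<open>Lp_space\<close> and \<open>Lp_norm\<close>\<close>

lemma Lp_spaceI_bounded:
  assumes "f \<in> borel_measurable M" "g \<in> Lp_space p M" "0 \<le> p" "AE x in M. norm (f x) \<le> C * norm (g x)"
  shows "f \<in> Lp_space p M"
proof -
  have "integrable M (\<lambda>x. norm (f x) powr p)"
  proof (rule Bochner_Integration.integrable_bound)
    \<comment> \<open>The absolute value is there because \<open>C\<close> carries no sign
      assumption.\<close>
    show "integrable M (\<lambda>x. \<bar>C\<bar> powr p * norm (g x) powr p)"
      using assms(2) by (auto simp: Lp_space_def)
    show "AE x in M. norm (norm (f x) powr p) \<le> norm (\<bar>C\<bar> powr p * norm (g x) powr p)"
      using assms(4)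
    proof eventually_elim
      case (elim x)
      also have "C * norm (g x) \<le> \<bar>C\<bar> * norm (g x)"
        by (simp add: mult_right_mono)
      finally show ?case
        using assms(3) by (simp add: powr_mono2 flip: powr_mult)
    qed
  qed (use assms(1) in measurable)
  then show ?thesis using assms(1) by (simp add: Lp_space_def)
qed

lemma Lp_norm_mono:
  assumes "f \<in> borel_measurable M" "g \<in> Lp_space p M" "0 \<le> p" "AE x in M. norm (f x) \<le> norm (g x)"
  shows "Lp_norm p M f \<le> Lp_norm p M g"
proof -
  have "f \<in> Lp_space p M"
    using assms by (intro Lp_spaceI_bounded[of f M g p 1]) auto
  then have "(LINT x|M. norm (f x) powr p) \<le> (LINT x|M. norm (g x) powr p)"
    using assms by (intro integral_mono_AE) (auto simp: Lp_space_def powr_mono2)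
  then show ?thesis
    using assms(3) by (simp add: Lp_norm_def powr_mono2)
qed

lemma Lp_space_cong_AE:
  assumes "f \<in> borel_measurable M" "g \<in> borel_measurable M" "AE x in M. f x = g x"
  shows "f \<in> Lp_space p M \<longleftrightarrow> g \<in> Lp_space p M"
proof -
  have "integrable M (\<lambda>x. norm (f x) powr p) \<longleftrightarrow> integrable M (\<lambda>x. norm (g x) powr p)"
    using assms by (intro integrable_cong_AE) auto
  then show ?thesis using assms by (simp add: Lp_space_def)
qed

lemma Lp_norm_cong_AE:
  assumes "f \<in> borel_measurable M" "g \<in> borel_measurable M" "AE x in M. f x = g x"
  shows "Lp_norm p M f = Lp_norm p M g"
proof -
  have "(LINT x|M. norm (f x) powr p) = (LINT x|M. norm (g x) powr p)"
    using assms by (intro integral_cong_AE) auto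
  then show ?thesis by (simp add: Lp_norm_def)
qed

lemma Lp_space_scale: "f \<in> Lp_space p M \<Longrightarrow> (\<lambda>x. c * f x) \<in> Lp_space p M"
  by (auto simp: Lp_space_def norm_mult powr_mult)

lemma Lp_norm_scale: "0 < p \<Longrightarrow> Lp_norm p M (\<lambda>x. c * f x) = norm c * Lp_norm p M f"
  by (simp add: Lp_norm_def norm_mult powr_mult powr_powr)

lemma Lp_norm_nonneg [simp]: "0 \<le> Lp_norm p M f"
  by (simp add: Lp_norm_def)

text \<open>Replacing x + y by twice the maximum is crude but treats convex and concave exponents
  alike; the quasi-triangle inequality uses it once with p and once with 1/p.\<close>

lemma powr_sum_le:
  fixes x y p :: real
  assumes "0 \<le> x" "0 \<le> y" "0 \<le> p"
  shows "(x + y) powr p \<le> 2 powr p * (x powr p + y powr p)"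
proof -
  have "(x + y) powr p \<le> (2 * max x y) powr p"
    using assms by (intro powr_mono2) auto
  also have "\<dots> = 2 powr p * max x y powr p"
    using assms by (simp add: powr_mult)
  also have "max x y powr p \<le> x powr p + y powr p"
    by (auto simp: max_def)
  finally show ?thesis by simp
qed

lemma Lp_space_add:
  assumes "f \<in> Lp_space p M" "g \<in> Lp_space p M" "0 \<le> p"
  shows "(\<lambda>x. f x + g x) \<in> Lp_space p M"
proof -
  have meas [measurable]: "f \<in> borel_measurable M" "g \<in> borel_measurable M"
    using assms by (auto simp: Lp_space_def)
  have "integrable M (\<lambda>x. norm (f x + g x) powr p)"
  proof (rule Bochner_Integration.integrable_bound)
    show "integrable M (\<lambda>x. 2 powr p * (norm (f x) powr p + norm (g x) powr p))"
      using assms by (auto simp: Lp_space_def)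
    show "AE x in M. norm (norm (f x + g x) powr p)
        \<le> norm (2 powr p * (norm (f x) powr p + norm (g x) powr p))"
    proof (rule AE_I2)
      fix x
      have "norm (f x + g x) powr p \<le> (norm (f x) + norm (g x)) powr p"
        using assms(3) by (intro powr_mono2 norm_triangle_ineq) auto
      also have "\<dots> \<le> 2 powr p * (norm (f x) powr p + norm (g x) powr p)"
        using assms(3) by (intro powr_sum_le) auto
      finally show "norm (norm (f x + g x) powr p)
        \<le> norm (2 powr p * (norm (f x) powr p + norm (g x) powr p))" by simp
    qed
  qed measurable
  then show ?thesis by (simp add: Lp_space_def)
qed

lemma Lp_space_diff:
  assumes "f \<in> Lp_space p M" "g \<in> Lp_space p M" "0 \<le> p"
  shows "(\<lambda>x. f x - g x) \<in> Lp_space p M"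
  using Lp_space_add[OF assms(1) Lp_space_scale[OF assms(2), of "-1"] assms(3)] by simp

text \<open>The constant is not sharp; a fixed constant suffices because the inequality is never iterated.\<close>

lemma Lp_norm_quasi_triangle:
  assumes f: "f \<in> Lp_space p M" and g: "g \<in> Lp_space p M" and p: "0 < p"
  shows "Lp_norm p M (\<lambda>x. f x + g x) \<le> 2 * 2 powr (1/p) * (Lp_norm p M f + Lp_norm p M g)"
proof -
  let ?I = "\<lambda>f. LINT x|M. norm (f x) powr p"
  have meas [measurable]: "f \<in> borel_measurable M" "g \<in> borel_measurable M"
    using assms by (auto simp: Lp_space_def)
  have "?I (\<lambda>x. f x + g x) \<le> (LINT x|M. 2 powr p * (norm (f x) powr p + norm (g x) powr p))"
  proof (rule integral_mono)
    show "integrable M (\<lambda>x. norm (f x + g x) powr p)"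
      using Lp_space_add[OF f g] p by (simp add: Lp_space_def)
    show "integrable M (\<lambda>x. 2 powr p * (norm (f x) powr p + norm (g x) powr p))"
      using assms by (auto simp: Lp_space_def)
    fix x
    have "norm (f x + g x) powr p \<le> (norm (f x) + norm (g x)) powr p"
      using p by (intro powr_mono2 norm_triangle_ineq) auto
    also have "\<dots> \<le> 2 powr p * (norm (f x) powr p + norm (g x) powr p)"
      using p by (intro powr_sum_le) auto
    finally show "norm (f x + g x) powr p
        \<le> 2 powr p * (norm (f x) powr p + norm (g x) powr p)" .
  qed
  also have "\<dots> = 2 powr p * (?I f + ?I g)"
    using f g by (simp add: Lp_space_def)
  finally have "?I (\<lambda>x. f x + g x) powr (1/p) \<le> (2 powr p * (?I f + ?I g)) powr (1/p)"
    using p by (intro powr_mono2) auto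
  also have "\<dots> = 2 * (?I f + ?I g) powr (1/p)"
    using p by (simp add: powr_mult powr_powr)
  also have "(?I f + ?I g) powr (1/p) \<le> 2 powr (1/p) * (?I f powr (1/p) + ?I g powr (1/p))"
    using p by (intro powr_sum_le) auto
  finally show ?thesis
    by (simp add: Lp_norm_def)
qed

lemma Lp_norm_zeroD:
  assumes "f \<in> Lp_space p M" "Lp_norm p M f = 0"
  shows "AE x in M. f x = 0"
proof -
  have "(LINT x|M. norm (f x) powr p) = 0"
    using assms by (simp add: Lp_norm_def)
  then have "AE x in M. norm (f x) powr p = 0"
    using assms by (subst (asm) integral_nonneg_eq_0_iff_AE) (auto simp: Lp_space_def)
  then show ?thesis by simp
qed

section \<open>Hoelder's inequality against a strictly positive weight\<close>

text \<open>Young's inequality for norm (f x) / A and h x, with A the norm of \<open>f\<close>, is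
  multiplied by A and integrated. The two terms then contribute A/p and at most A/q, which add up to
  A. The division by A forces the separate case of norm zero.\<close>

lemma nn_integral_Holder_unit:
  fixes h :: "'a \<Rightarrow> real"
  assumes pq: "1 < p" "1 < q" "1 / p + 1 / q = 1" and f: "f \<in> Lp_space p M"
    and h [measurable]: "h \<in> borel_measurable M" and h0: "\<And>x. 0 \<le> h x"
    and h1: "(\<integral>\<^sup>+ x. ennreal (h x powr q) \<partial>M) \<le> 1"
  shows "(\<integral>\<^sup>+ x. ennreal (norm (f x) * h x) \<partial>M) \<le> ennreal (Lp_norm p M f)"
proof (cases "Lp_norm p M f = 0")
  case True
  then have "AE x in M. f x = 0"
    by (rule Lp_norm_zeroD[OF f])
  then have "(\<integral>\<^sup>+ x. ennreal (norm (f x) * h x) \<partial>M) = (\<integral>\<^sup>+ x. 0 \<partial>M)"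
    by (intro nn_integral_cong_AE) auto
  then show ?thesis by simp
next
  case False
  define A where "A = Lp_norm p M f"
  have A: "0 < A"
    using False by (simp add: A_def order_less_le)
  have Ap: "A powr p = (LINT x|M. norm (f x) powr p)"
    using pq by (simp add: A_def Lp_norm_def powr_powr)
  have [measurable]: "f \<in> borel_measurable M"
    using f by (simp add: Lp_space_def)
  have pt: "norm (f x) * h x \<le> (A / (p * A powr p)) * norm (f x) powr p + (A / q) * h x powr q" for x
  proof -
    have "norm (f x) * h x = A * ((norm (f x) / A) * h x)"
      using A by simp
    also have "(norm (f x) / A) * h x \<le> (norm (f x) / A) powr p / p + h x powr q / q"
      using pq A h0 by (intro Youngs_inequality) auto
    finally show ?thesis
      using A by (simp add: powr_divide distrib_left mult_ac)
  qed
  have If: "(\<integral>\<^sup>+ x. ennreal (norm (f x) powr p) \<partial>M) = ennreal (A powr p)"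
    using f unfolding Ap by (intro nn_integral_eq_integral) (auto simp: Lp_space_def)
  have "(\<integral>\<^sup>+ x. ennreal (norm (f x) * h x) \<partial>M)
      \<le> (\<integral>\<^sup>+ x. ennreal (A / (p * A powr p)) * ennreal (norm (f x) powr p)
              + ennreal (A / q) * ennreal (h x powr q) \<partial>M)"
    using A pq pt
    by (intro nn_integral_mono) (simp add: ennreal_leI flip: ennreal_mult ennreal_plus)
  also have "\<dots> = ennreal (A / (p * A powr p)) * ennreal (A powr p)
              + ennreal (A / q) * (\<integral>\<^sup>+ x. ennreal (h x powr q) \<partial>M)"
    by (simp add: nn_integral_add nn_integral_cmult If)
  also have "\<dots> \<le> ennreal (A / (p * A powr p)) * ennreal (A powr p) + ennreal (A / q) * 1"
    by (intro add_left_mono mult_left_mono h1) auto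
  also have "\<dots> = ennreal (A / p + A / q)"
    using A pq by (simp flip: ennreal_mult ennreal_plus)
  also have "A / p + A / q = A"
    using pq(3) by (metis distrib_left mult.right_neutral times_divide_eq_right)
  finally show ?thesis by (simp add: A_def)
qed

text \<open>On a \<sigma>-finite space there is a strictly positive function with finite integral;
  \<open>h\<close> is the q-th root of its normalisation. Strict positivity is what later turns a
  vanishing weighted integral into equality almost everywhere.\<close>

lemma (in sigma_finite_measure) Ex_positive_powr_integrable:
  assumes "0 < q"
  obtains h :: "'a \<Rightarrow> real" where "h \<in> borel_measurable M" "\<And>x. 0 \<le> h x" "\<And>x. x \<in> space M \<Longrightarrow> 0 < h x"
    "(\<integral>\<^sup>+ x. ennreal (h x powr q) \<partial>M) \<le> 1"
proof -
  obtain g where g [measurable]: "g \<in> borel_measurable M" and gi: "integral\<^sup>N M g \<noteq> \<infinity>"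
    and gp: "\<And>x. x \<in> space M \<Longrightarrow> 0 < g x \<and> g x < \<infinity>"
    using Ex_finite_integrable_function by blast
  \<comment> \<open>The summand 1 keeps the divisor positive even if the integral of
    \<open>g\<close> is zero.\<close>
  define J where "J = 1 + enn2real (integral\<^sup>N M g)"
  have J: "1 \<le> J" "integral\<^sup>N M g \<le> ennreal J"
    using gi unfolding J_def by (auto simp: ennreal_enn2real_if top.not_eq_extremum)
  define h where "h x = (enn2real (g x) / J) powr (1 / q)" for x
  show thesis
  proof
    show "h \<in> borel_measurable M"
      unfolding h_def by measurable
    show "0 \<le> h x" for x
      by (simp add: h_def)
    show "0 < h x" if "x \<in> space M" for x
    proof -
      have "0 < enn2real (g x)"
        using gp[OF that] by (simp add: enn2real_positive_iff)
      then show ?thesis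
        using J by (simp add: h_def)
    qed
    have "(\<integral>\<^sup>+ x. ennreal (h x powr q) \<partial>M) = (\<integral>\<^sup>+ x. ennreal (1 / J) * g x \<partial>M)"
    proof (rule nn_integral_cong)
      fix x assume x: "x \<in> space M"
      have "h x powr q = 1 / J * enn2real (g x)"
        using assms J by (simp add: h_def powr_powr)
      then have "ennreal (h x powr q) = ennreal (1 / J) * ennreal (enn2real (g x))"
        using J by (simp only: ennreal_mult' divide_nonneg_nonneg enn2real_nonneg)
      then show "ennreal (h x powr q) = ennreal (1 / J) * g x"
        using gp[OF x] by simp
    qed
    also have "\<dots> = ennreal (1 / J) * integral\<^sup>N M g"
      by (rule nn_integral_cmult) simp
    also have "\<dots> \<le> ennreal (1 / J) * ennreal J"
      by (intro mult_left_mono J) simp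
    also have "\<dots> = 1"
      using J by (simp flip: ennreal_mult)
    finally show "(\<integral>\<^sup>+ x. ennreal (h x powr q) \<partial>M) \<le> 1" .
  qed
qed

section \<open>Step functions with values in L^p and uniqueness of the Bochner integral\<close>

lemma Lp_space_sum:
  assumes "0 < p" "\<And>i. i \<in> I \<Longrightarrow> f i \<in> Lp_space p M"
  shows "(\<lambda>x. \<Sum>i\<in>I. f i x) \<in> Lp_space p M"
  using assms(2)
proof (induction I rule: infinite_finite_induct)
  case (insert i I)
  then show ?case
    using Lp_space_add[of "f i" p M "\<lambda>x. \<Sum>i\<in>I. f i x"] assms(1) by simp
qed (auto simp: Lp_space_def)

text \<open>Each s lies in exactly one level set, so one summand survives. The expansion separates
  the variables s and \<omega>, and from it both the scalar integral at a fixed \<omega> and joint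
  measurability are read off.\<close>

lemma simple_function_eq_sum_indicator:
  fixes S :: "'s \<Rightarrow> 'a \<Rightarrow> complex"
  assumes "simple_function K S" "s \<in> space K"
  shows "S s \<omega> = (\<Sum>y\<in>S ` space K. indicator {s \<in> space K. S s = y} s * y \<omega>)"
proof -
  have "(\<Sum>y\<in>S ` space K. indicator {s \<in> space K. S s = y} s * y \<omega>)
      = (\<Sum>y\<in>S ` space K. if y = S s then S s \<omega> else 0)"
    using assms(2) by (intro sum.cong) (auto simp: indicator_def)
  also have "\<dots> = S s \<omega>"
    using assms by (auto simp: simple_function_def)
  finally show ?thesis by simp
qed

lemma simple_function_level_set [measurable]:
  assumes "simple_function K S"
  shows "{s \<in> space K. S s = y} \<in> sets K"
  using simple_functionD(2)[OF assms, of "{y}"] by (simp add: vimage_def Int_def conj_commute)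

lemma has_bochner_integral_simple_function:
  fixes S :: "'s \<Rightarrow> 'a \<Rightarrow> complex"
  assumes "finite_measure K" "simple_function K S"
  shows "has_bochner_integral K (\<lambda>s. S s \<omega>) (simple_Lp_integral K S \<omega>)"
proof -
  interpret finite_measure K by fact
  have "has_bochner_integral K
      (\<lambda>s. \<Sum>y\<in>S ` space K. indicator {s \<in> space K. S s = y} s *\<^sub>R y \<omega>)
      (\<Sum>y\<in>S ` space K. measure K {s \<in> space K. S s = y} *\<^sub>R y \<omega>)"
    using simple_function_level_set[OF assms(2)]
    by (intro has_bochner_integral_sum has_bochner_integral_indicator)
      (auto simp: less_top[symmetric])
  then show ?thesis
    unfolding simple_Lp_integral_def
    by (rule has_bochner_integral_cong[THEN iffD1, rotated -1])
      (auto simp: simple_function_eq_sum_indicator[OF assms(2)] scaleR_conv_of_real of_real_indicator)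
qed

text \<open>Joint measurability is what Tonelli's theorem asks for. It does not follow from
  measurability in each variable, but it does from the finite sum of products.\<close>

lemma borel_measurable_pair_simple_function:
  fixes S :: "'s \<Rightarrow> 'a \<Rightarrow> complex"
  assumes S: "simple_function K S" and N: "S ` space K \<subseteq> borel_measurable N"
  shows "(\<lambda>(\<omega>, s). S s \<omega>) \<in> borel_measurable (N \<Otimes>\<^sub>M K)"
proof -
  have "(\<lambda>z. \<Sum>y\<in>S ` space K. indicator {s \<in> space K. S s = y} (snd z) * y (fst z))
      \<in> borel_measurable (N \<Otimes>\<^sub>M K)"
  proof (rule borel_measurable_sum)
    fix y assume "y \<in> S ` space K"
    then have [measurable]: "y \<in> borel_measurable N" "{s \<in> space K. S s = y} \<in> sets K"
      using N simple_function_level_set[OF S] by auto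
    show "(\<lambda>z. indicator {s \<in> space K. S s = y} (snd z) * y (fst z)) \<in> borel_measurable (N \<Otimes>\<^sub>M K)"
      by measurable
  qed
  then show ?thesis
    by (rule measurable_cong[THEN iffD1, rotated])
      (auto simp: space_pair_measure simple_function_eq_sum_indicator[OF S])
qed

text \<open>
  Pairing with a strictly positive weight in the dual exponent reduces a Bochner integral in
  $L^p$ to Tonelli's theorem.
\<close>

lemma has_Lp_bochner_integral_AE_eq:
  fixes F :: "'s \<Rightarrow> 'a \<Rightarrow> complex"
  assumes "1 < p" "sigma_finite_measure N" "finite_measure K"
    and F [measurable]: "(\<lambda>(\<omega>, s). F s \<omega>) \<in> borel_measurable (N \<Otimes>\<^sub>M K)"
    and Fint: "\<And>\<omega>. \<omega> \<in> space N \<Longrightarrow> integrable K (\<lambda>s. F s \<omega>)"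
    and x: "has_Lp_bochner_integral p N K F x"
  shows "AE \<omega> in N. x \<omega> = (LINT s|K. F s \<omega>)"
proof -
  interpret N: sigma_finite_measure N by fact
  interpret K: finite_measure K by fact
  interpret NK: pair_sigma_finite N K ..
  define q where "q = p / (p - 1)"
  have q: "1 < q" "1 / p + 1 / q = 1"
    using assms(1) by (auto simp: q_def field_simps)
  obtain h :: "'a \<Rightarrow> real" where h [measurable]: "h \<in> borel_measurable N"
    and h0: "\<And>x. 0 \<le> h x" and hpos: "\<And>x. x \<in> space N \<Longrightarrow> 0 < h x"
    and h1: "(\<integral>\<^sup>+ x. ennreal (h x powr q) \<partial>N) \<le> 1"
    using N.Ex_positive_powr_integrable[of q] q by auto
  note Holder = nn_integral_Holder_unit[OF assms(1) q _ h h0 h1]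
  define \<psi> where "\<psi> \<omega> = (LINT s|K. F s \<omega>)" for \<omega>
  have [measurable]: "\<psi> \<in> borel_measurable N"
    unfolding \<psi>_def by measurable
  from x obtain S where xLp: "x \<in> Lp_space p N" and FLp: "\<And>s. s \<in> space K \<Longrightarrow> F s \<in> Lp_space p N"
    and S: "\<And>n::nat. simple_Lp_integrable p N K (S n)"
    and lim1: "(\<lambda>n. \<integral>\<^sup>+ s. ennreal (Lp_norm p N (\<lambda>\<omega>. F s \<omega> - S n s \<omega>)) \<partial>K) \<longlonglongrightarrow> 0"
    and lim2: "(\<lambda>n. Lp_norm p N (\<lambda>\<omega>. simple_Lp_integral K (S n) \<omega> - x \<omega>)) \<longlonglongrightarrow> 0"
    by (auto simp: has_Lp_bochner_integral_def)
  have [measurable]: "x \<in> borel_measurable N"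
    using xLp by (simp add: Lp_space_def)
  let ?e1 = "\<lambda>n. \<integral>\<^sup>+ s. ennreal (Lp_norm p N (\<lambda>\<omega>. F s \<omega> - S n s \<omega>)) \<partial>K"
  let ?e2 = "\<lambda>n. ennreal (Lp_norm p N (\<lambda>\<omega>. simple_Lp_integral K (S n) \<omega> - x \<omega>))"
  let ?D = "\<integral>\<^sup>+ \<omega>. ennreal (norm (\<psi> \<omega> - x \<omega>) * h \<omega>) \<partial>N"
  \<comment> \<open>Inserting the integral of the n-th step function splits the weighted L^1
    distance \<open>?D\<close> into an error of integrands and an error of integrals. These are the
    two quantities that the definition sends to zero, whereas \<open>?D\<close> does not depend on
    n.\<close>
  have D_le: "?D \<le> ?e1 n + ?e2 n" for n
  proof -
    have Sn: "simple_function K (S n)" "\<And>s. s \<in> space K \<Longrightarrow> S n s \<in> Lp_space p N"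
      using S[of n] by (auto simp: simple_Lp_integrable_def)
    have [measurable]: "(\<lambda>(\<omega>, s). S n s \<omega>) \<in> borel_measurable (N \<Otimes>\<^sub>M K)"
      using Sn by (intro borel_measurable_pair_simple_function) (auto simp: Lp_space_def)
    let ?I = "simple_Lp_integral K (S n)"
    have SI: "has_bochner_integral K (\<lambda>s. S n s \<omega>) (?I \<omega>)" for \<omega>
      using has_bochner_integral_simple_function[OF \<open>finite_measure K\<close> Sn(1)] .
    have ILp: "?I \<in> Lp_space p N"
      unfolding simple_Lp_integral_def using assms(1) Sn(2)
      by (intro Lp_space_sum Lp_space_scale) auto
    have [measurable]: "?I \<in> borel_measurable N"
      using ILp by (simp add: Lp_space_def)
    have "(\<integral>\<^sup>+ \<omega>. ennreal (norm (\<psi> \<omega> - ?I \<omega>) * h \<omega>) \<partial>N)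
        \<le> (\<integral>\<^sup>+ \<omega>. \<integral>\<^sup>+ s. ennreal (norm (F s \<omega> - S n s \<omega>) * h \<omega>) \<partial>K \<partial>N)"
    proof (rule nn_integral_mono)
      fix \<omega> assume \<omega>: "\<omega> \<in> space N"
      have int: "integrable K (\<lambda>s. F s \<omega> - S n s \<omega>)"
        using Fint[OF \<omega>] SI[of \<omega>] by (auto dest: has_bochner_integral_iff[THEN iffD1])
      have "\<psi> \<omega> - ?I \<omega> = (LINT s|K. F s \<omega> - S n s \<omega>)"
        using Fint[OF \<omega>] SI[of \<omega>] by (auto simp: \<psi>_def has_bochner_integral_iff)
      then have "ennreal (norm (\<psi> \<omega> - ?I \<omega>)) \<le> (\<integral>\<^sup>+ s. ennreal (norm (F s \<omega> - S n s \<omega>)) \<partial>K)"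
        using integral_norm_bound_ennreal[OF int] by simp
      then have "ennreal (norm (\<psi> \<omega> - ?I \<omega>)) * ennreal (h \<omega>)
          \<le> (\<integral>\<^sup>+ s. ennreal (norm (F s \<omega> - S n s \<omega>)) \<partial>K) * ennreal (h \<omega>)"
        by (rule mult_right_mono) simp
      also have "\<dots> = (\<integral>\<^sup>+ s. ennreal (norm (F s \<omega> - S n s \<omega>)) * ennreal (h \<omega>) \<partial>K)"
        using borel_measurable_integrable[OF int] by (intro nn_integral_multc[symmetric]) auto
      finally show "ennreal (norm (\<psi> \<omega> - ?I \<omega>) * h \<omega>)
          \<le> (\<integral>\<^sup>+ s. ennreal (norm (F s \<omega> - S n s \<omega>) * h \<omega>) \<partial>K)"
        by (simp add: ennreal_mult h0)
    qed
    \<comment> \<open>With \<omega> as the inner variable, Hoelder against \<open>h\<close> at fixed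
      s yields exactly the norm of F s - S n s that occurs in \<open>?e1\<close>.\<close>
    also have "\<dots> = (\<integral>\<^sup>+ s. \<integral>\<^sup>+ \<omega>. ennreal (norm (F s \<omega> - S n s \<omega>) * h \<omega>) \<partial>N \<partial>K)"
      by (rule NK.Fubini'[symmetric]) measurable
    also have "\<dots> \<le> ?e1 n"
      using FLp Sn(2) assms(1) by (intro nn_integral_mono Holder Lp_space_diff) auto
    finally have 1: "(\<integral>\<^sup>+ \<omega>. ennreal (norm (\<psi> \<omega> - ?I \<omega>) * h \<omega>) \<partial>N) \<le> ?e1 n" .
    have 2: "(\<integral>\<^sup>+ \<omega>. ennreal (norm (?I \<omega> - x \<omega>) * h \<omega>) \<partial>N) \<le> ?e2 n"
      using ILp xLp assms(1) by (intro Holder Lp_space_diff) auto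
    have "?D \<le> (\<integral>\<^sup>+ \<omega>. ennreal (norm (\<psi> \<omega> - ?I \<omega>) * h \<omega>) + ennreal (norm (?I \<omega> - x \<omega>) * h \<omega>) \<partial>N)"
    proof (rule nn_integral_mono)
      fix \<omega>
      have "norm (\<psi> \<omega> - x \<omega>) * h \<omega> \<le> (norm (\<psi> \<omega> - ?I \<omega>) + norm (?I \<omega> - x \<omega>)) * h \<omega>"
        using norm_triangle_ineq[of "\<psi> \<omega> - ?I \<omega>" "?I \<omega> - x \<omega>"] h0 by (intro mult_right_mono) auto
      then show "ennreal (norm (\<psi> \<omega> - x \<omega>) * h \<omega>)
          \<le> ennreal (norm (\<psi> \<omega> - ?I \<omega>) * h \<omega>) + ennreal (norm (?I \<omega> - x \<omega>) * h \<omega>)"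
        using h0 by (simp add: distrib_right ennreal_leI flip: ennreal_plus)
    qed
    also have "\<dots> = (\<integral>\<^sup>+ \<omega>. ennreal (norm (\<psi> \<omega> - ?I \<omega>) * h \<omega>) \<partial>N)
        + (\<integral>\<^sup>+ \<omega>. ennreal (norm (?I \<omega> - x \<omega>) * h \<omega>) \<partial>N)"
      by (rule nn_integral_add) auto
    finally show ?thesis
      using add_mono[OF 1 2] by (rule order_trans)
  qed
  have "(\<lambda>n. ?e1 n + ?e2 n) \<longlonglongrightarrow> 0 + ennreal 0"
    by (intro tendsto_add lim1 tendsto_ennrealI lim2)
  then have "?D \<le> 0"
    by (intro LIMSEQ_le_const[of "\<lambda>n. ?e1 n + ?e2 n"]) (auto intro: D_le)
  then have "AE \<omega> in N. ennreal (norm (\<psi> \<omega> - x \<omega>) * h \<omega>) = 0"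
    by (subst nn_integral_0_iff_AE[symmetric]) auto
  then show ?thesis
  proof (rule AE_mp, intro AE_I2 impI)
    fix \<omega> assume \<omega>: "\<omega> \<in> space N" and "ennreal (norm (\<psi> \<omega> - x \<omega>) * h \<omega>) = 0"
    then have "norm (\<psi> \<omega> - x \<omega>) * h \<omega> \<le> 0"
      by (simp add: ennreal_eq_0_iff)
    then have "norm (\<psi> \<omega> - x \<omega>) \<le> 0"
      using hpos[OF \<omega>] by (simp add: mult_le_0_iff)
    then show "x \<omega> = (LINT s|K. F s \<omega>)"
      by (simp add: \<psi>_def)
  qed
qed

section \<open>Existence of the Bochner integral along a semigroup orbit\<close>

text \<open>The derivative of exp is bounded by exp C on the convex half-plane Re z \<le> C, which
  gives the Lipschitz part; the triangle inequality gives the factor 2. Both parts are wanted: the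
  first makes the difference small at each point, the second dominates it when x - y is
  unbounded.\<close>

lemma norm_exp_diff_le:
  fixes x y :: complex
  assumes "Re x \<le> C" "Re y \<le> C"
  shows "norm (exp x - exp y) \<le> exp C * min 2 (norm (x - y))"
proof -
  have "norm (exp x - exp y) \<le> exp C * norm (x - y)"
  proof (rule field_differentiable_bound)
    show "convex {z. Re z \<le> C}"
      by (rule convex_halfspace_Re_le)
    show "(exp has_field_derivative exp z) (at z within {z. Re z \<le> C})" for z :: complex
      by (rule DERIV_subset[OF DERIV_exp]) simp
  qed (use assms in auto)
  moreover have "norm (exp x - exp y) \<le> exp C * 2"
  proof -
    have "norm (exp x) \<le> exp C" "norm (exp y) \<le> exp C"
      using assms by auto
    then show ?thesis
      using norm_triangle_ineq4[of "exp x" "exp y"] by linarith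
  qed
  ultimately show ?thesis
    by (auto simp: min_def)
qed

lemma Lp_norm_dominated_convergence_zero:
  fixes f :: "nat \<Rightarrow> 'a \<Rightarrow> complex"
  assumes p: "0 < p" and "\<And>n. f n \<in> borel_measurable M" "g \<in> Lp_space p M"
    and "\<And>\<omega>. (\<lambda>n. f n \<omega>) \<longlonglongrightarrow> 0" "\<And>n \<omega>. norm (f n \<omega>) \<le> norm (g \<omega>)"
  shows "(\<lambda>n. Lp_norm p M (f n)) \<longlonglongrightarrow> 0"
proof -
  have "(\<lambda>n. LINT \<omega>|M. norm (f n \<omega>) powr p) \<longlonglongrightarrow> (LINT \<omega>|M. 0)"
  proof (rule integral_dominated_convergence)
    show "AE \<omega> in M. (\<lambda>n. norm (f n \<omega>) powr p) \<longlonglongrightarrow> 0"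
    proof (rule AE_I2)
      fix \<omega>
      have "(\<lambda>n. norm (f n \<omega>)) \<longlonglongrightarrow> 0"
        using assms(4) by (rule tendsto_norm_zero)
      then show "(\<lambda>n. norm (f n \<omega>) powr p) \<longlonglongrightarrow> 0"
        using p by (intro tendsto_zero_powrI[where b=p]) auto
    qed
    show "integrable M (\<lambda>\<omega>. norm (g \<omega>) powr p)"
      using assms(3) by (simp add: Lp_space_def)
    show "AE \<omega> in M. norm (norm (f n \<omega>) powr p) \<le> norm (g \<omega>) powr p" for n
      using assms(5) p by (auto intro!: powr_mono2)
  qed (use assms(2) in measurable)
  then show ?thesis
    unfolding Lp_norm_def using p by (intro tendsto_zero_powrI[where b="1/p"]) auto
qed

text \<open>On [0,t] the kernel is at most exp (t * |Re z|), the absolute value covering both signs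
  of Re z. As this works for every z, the pointwise integral makes sense at every \<omega>,
  including those where Re (a \<omega>) exceeds its essential bound.\<close>

lemma integrable_exp_mult:
  fixes u :: "real \<Rightarrow> complex"
  assumes "integrable (restrict_space lborel {0..t}) u"
  shows "integrable (restrict_space lborel {0..t}) (\<lambda>s. exp (complex_of_real (t - s) * z) * u s)"
proof (rule Bochner_Integration.integrable_bound)
  let ?K = "restrict_space lborel {0..t}"
  show "integrable ?K (\<lambda>s. complex_of_real (exp (t * \<bar>Re z\<bar>)) * u s)"
    using assms by simp
  have [measurable]: "u \<in> borel_measurable ?K"
    using assms by auto
  have [measurable]: "(\<lambda>s. s) \<in> borel_measurable ?K"
    by (rule measurable_restrict_space1) simp
  show "(\<lambda>s. exp (complex_of_real (t - s) * z) * u s) \<in> borel_measurable ?K"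
    by measurable
  show "AE s in ?K. norm (exp (complex_of_real (t - s) * z) * u s)
      \<le> norm (complex_of_real (exp (t * \<bar>Re z\<bar>)) * u s)"
  proof (rule AE_I2)
    fix s assume "s \<in> space ?K"
    then have s: "0 \<le> s" "s \<le> t"
      by (auto simp: space_restrict_space)
    then have "(t - s) * Re z \<le> (t - s) * \<bar>Re z\<bar>" "(t - s) * \<bar>Re z\<bar> \<le> t * \<bar>Re z\<bar>"
      by (auto intro: mult_left_mono mult_right_mono)
    then show "norm (exp (complex_of_real (t - s) * z) * u s)
        \<le> norm (complex_of_real (exp (t * \<bar>Re z\<bar>)) * u s)"
      by (auto simp: norm_mult intro!: mult_right_mono)
  qed
qed

text \<open>The step functions sample the semigroup on a time grid and replace \<open>u\<close> by
  simple functions \<open>U n\<close>. Their error has two sources: moving s to the grid point,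
  controlled by strong continuity on \<open>b\<close>, and replacing \<open>u\<close> by
  \<open>U n\<close>, controlled by the bound \<open>k\<close> of the semigroup on [0,t]. The
  measure \<open>N\<close> is arbitrary here; it is later the weighted measure, in which
  \<open>b\<close> has finite norm.\<close>

lemma has_Lp_bochner_integral_mult_semigroup:
  fixes a b x :: "'a \<Rightarrow> complex" and u :: "real \<Rightarrow> complex"
  defines "K \<equiv> \<lambda>t. restrict_space lborel {0..t::real}"
  assumes q: "0 < q" and t: "0 \<le> t" and a [measurable]: "a \<in> borel_measurable N"
    and ac: "AE \<omega> in N. Re (a \<omega>) \<le> c"
    and b: "b \<in> Lp_space q N" and u: "integrable (K t) u" and x: "x \<in> borel_measurable N"
    and x_eq: "AE \<omega> in N. x \<omega> = b \<omega> * (LINT s|K t. exp (complex_of_real (t - s) * a \<omega>) * u s)"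
  shows "has_Lp_bochner_integral q N (K t) (\<lambda>s \<omega>. mult_semigroup a (t - s) b \<omega> * u s) x"
proof -
  \<comment> \<open>This bounds the modulus of exp (w a) for all w in [0,t] at once; with c itself
    in place of |c| this would fail at w = 0 for negative c and t > 0.\<close>
  define k where "k = exp (t * \<bar>c\<bar>)"
  have k: "0 < k" by (simp add: k_def)
  interpret K: finite_measure "K t"
    by (rule finite_measureI) (use t in \<open>auto simp: K_def space_restrict_space emeasure_restrict_space\<close>)
  have spK: "space (K t) = {0..t}"
    by (auto simp: K_def space_restrict_space)
  have [measurable]: "b \<in> borel_measurable N"
    using b by (simp add: Lp_space_def)
  have u_meas [measurable]: "u \<in> borel_measurable (K t)"
    using u by auto
  note x [measurable]
  obtain U where U: "\<And>n. simple_function (K t) (U n)"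
    and Ulim: "\<And>s. s \<in> space (K t) \<Longrightarrow> (\<lambda>n. U n s) \<longlonglongrightarrow> u s"
    and Ule: "\<And>n s. s \<in> space (K t) \<Longrightarrow> dist (U n s) 0 \<le> 2 * dist (u s) 0"
    using borel_measurable_implies_sequence_metric[OF u_meas, of 0] by blast
  have [measurable]: "U n \<in> borel_measurable (K t)" for n
    by (rule borel_measurable_simple_function[OF U])
  \<comment> \<open>Rounding down to the grid of mesh 1/(n+1) keeps \<open>\<tau> n s\<close>
    between 0 and s, so t - \<open>\<tau> n s\<close> stays in [0,t], where \<open>k\<close> bounds
    the exponential.\<close>
  define \<tau> where "\<tau> n s = real_of_int \<lfloor>s * real (Suc n)\<rfloor> / real (Suc n)" for n s
  have \<tau>: "0 \<le> \<tau> n s" "\<tau> n s \<le> s" "s - \<tau> n s \<le> 1 / real (Suc n)" if "0 \<le> s" for n s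
  proof -
    show "0 \<le> \<tau> n s"
      using that by (simp add: \<tau>_def)
    show "\<tau> n s \<le> s"
      unfolding \<tau>_def by (subst divide_le_eq) (simp add: mult.commute)
    have "s * real (Suc n) - 1 \<le> real_of_int \<lfloor>s * real (Suc n)\<rfloor>"
      by linarith
    then have "(s * real (Suc n) - 1) / real (Suc n) \<le> \<tau> n s"
      unfolding \<tau>_def by (intro divide_right_mono) auto
    then show "s - \<tau> n s \<le> 1 / real (Suc n)"
      by (simp add: diff_divide_distrib)
  qed
  have \<tau>_simple: "simple_function (K t) (\<tau> n)" for n
  proof (rule simple_function_borel_measurable)
    show "\<tau> n \<in> borel_measurable (K t)"
      unfolding \<tau>_def K_def by (rule measurable_restrict_space1) simp
    have "\<tau> n ` space (K t) \<subseteq> (\<lambda>i. real_of_int i / real (Suc n)) ` {0..\<lfloor>t * real (Suc n)\<rfloor>}"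
    proof
      fix y assume "y \<in> \<tau> n ` space (K t)"
      then obtain s where "y = \<tau> n s" "0 \<le> s" "s \<le> t"
        by (auto simp: spK)
      then show "y \<in> (\<lambda>i. real_of_int i / real (Suc n)) ` {0..\<lfloor>t * real (Suc n)\<rfloor>}"
        by (auto simp: \<tau>_def intro!: image_eqI floor_mono mult_right_mono)
    qed
    then show "finite (\<tau> n ` space (K t))"
      by (rule finite_subset) simp
  qed
  define S where "S n s = (\<lambda>\<omega>. exp (complex_of_real (t - \<tau> n s) * a \<omega>) * b \<omega> * U n s)" for n s
  have S_simple: "simple_function (K t) (S n)" for n
  proof -
    \<comment> \<open>The dependence on s passes through a pair of scalar simple functions, so
      finitely many values and measurable level sets are inherited.\<close>
    have eq: "S n = (\<lambda>(w, v) \<omega>. exp (complex_of_real (t - w) * a \<omega>) * b \<omega> * v) \<circ> (\<lambda>s. (\<tau> n s, U n s))"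
      by (auto simp: S_def fun_eq_iff)
    show ?thesis
      unfolding eq by (intro simple_function_compose simple_function_Pair U \<tau>_simple)
  qed
  have exp_le: "norm (exp (complex_of_real w * a \<omega>)) \<le> k" and Re_le: "Re (complex_of_real w * a \<omega>) \<le> t * \<bar>c\<bar>"
    if "Re (a \<omega>) \<le> c" "0 \<le> w" "w \<le> t" for w \<omega>
  proof -
    have "w * Re (a \<omega>) \<le> w * \<bar>c\<bar>"
      using that by (intro mult_left_mono) auto
    also have "\<dots> \<le> t * \<bar>c\<bar>"
      using that by (intro mult_right_mono) auto
    finally show "Re (complex_of_real w * a \<omega>) \<le> t * \<bar>c\<bar>"
      by simp
    then show "norm (exp (complex_of_real w * a \<omega>)) \<le> k"
      by (simp add: k_def)
  qed
  have TLp: "(\<lambda>\<omega>. exp (complex_of_real w * a \<omega>) * b \<omega> * z) \<in> Lp_space q N" if "0 \<le> w" "w \<le> t" for w z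
  proof (rule Lp_spaceI_bounded)
    show "b \<in> Lp_space q N" "0 \<le> q" using b q by auto
    show "AE \<omega> in N. norm (exp (complex_of_real w * a \<omega>) * b \<omega> * z) \<le> (k * norm z) * norm (b \<omega>)"
      using ac
    proof eventually_elim
      case (elim \<omega>)
      have "norm (exp (complex_of_real w * a \<omega>)) * (norm (b \<omega>) * norm z) \<le> k * (norm (b \<omega>) * norm z)"
        using exp_le[OF elim that] by (intro mult_right_mono) auto
      then show ?case by (simp only: norm_mult mult_ac)
    qed
  qed measurable
  \<comment> \<open>Bound for the error of sampling the exponential, uniform in s because the time
    shift is at most 1/(n+1). It tends to zero at every \<omega> and never exceeds 2k, though not
    uniformly in \<omega> if \<open>a\<close> is unbounded.\<close>
  define d where "d n \<omega> = k * min 2 (norm (a \<omega>) / real (Suc n))" for n \<omega>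
  have d0: "0 \<le> d n \<omega>" "d n \<omega> \<le> k * 2" for n \<omega>
    using k by (auto simp: d_def intro!: mult_left_mono)
  have [measurable]: "d n \<in> borel_measurable N" for n
    unfolding d_def by measurable
  have diff_le: "norm (exp (complex_of_real (t - s) * a \<omega>) * u s
      - exp (complex_of_real (t - \<tau> n s) * a \<omega>) * U n s) \<le> d n \<omega> * norm (u s) + k * norm (u s - U n s)"
    if "Re (a \<omega>) \<le> c" "s \<in> space (K t)" for n s \<omega>
  proof -
    have s: "0 \<le> s" "s \<le> t" using that(2) by (auto simp: spK)
    note \<tau>s = \<tau>[OF s(1), of n]
    let ?x = "complex_of_real (t - s) * a \<omega>" and ?y = "complex_of_real (t - \<tau> n s) * a \<omega>"
    have "?x - ?y = complex_of_real (\<tau> n s - s) * a \<omega>"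
      by (simp add: algebra_simps)
    then have "norm (?x - ?y) = (s - \<tau> n s) * norm (a \<omega>)"
      using \<tau>s by (simp add: norm_mult del: of_real_diff)
    also have "\<dots> \<le> norm (a \<omega>) / real (Suc n)"
      using mult_right_mono[OF \<tau>s(3), of "norm (a \<omega>)"] by simp
    finally have xy: "norm (?x - ?y) \<le> norm (a \<omega>) / real (Suc n)" .
    have "norm (exp ?x - exp ?y) \<le> exp (t * \<bar>c\<bar>) * min 2 (norm (?x - ?y))"
      using Re_le[OF that(1)] s \<tau>s by (intro norm_exp_diff_le) auto
    also have "\<dots> \<le> d n \<omega>"
      unfolding d_def k_def using xy by (intro mult_left_mono min.mono) auto
    finally have 1: "norm ((exp ?x - exp ?y) * u s) \<le> d n \<omega> * norm (u s)"
      by (simp add: norm_mult mult_right_mono)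
    have 2: "norm (exp ?y * (u s - U n s)) \<le> k * norm (u s - U n s)"
      using exp_le[OF that(1), of "t - \<tau> n s"] s \<tau>s by (simp add: norm_mult mult_right_mono)
    have "exp ?x * u s - exp ?y * U n s = (exp ?x - exp ?y) * u s + exp ?y * (u s - U n s)"
      by (simp add: algebra_simps)
    then show ?thesis
      using norm_triangle_mono[OF 1 2] by simp
  qed
  \<comment> \<open>A bound for the modulus of continuity of the orbit of \<open>b\<close> at mesh
    1/(n+1); it tends to zero by dominated convergence with majorant 2k|b|.\<close>
  define \<epsilon> where "\<epsilon> n = Lp_norm q N (\<lambda>\<omega>. complex_of_real (d n \<omega>) * b \<omega>)" for n
  have dbLp: "(\<lambda>\<omega>. complex_of_real (d n \<omega>) * b \<omega>) \<in> Lp_space q N" for n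
  proof (rule Lp_spaceI_bounded[where C="k * 2"])
    have "norm (complex_of_real (d n \<omega>) * b \<omega>) \<le> k * 2 * norm (b \<omega>)" for \<omega>
      using mult_right_mono[OF d0(2), of "norm (b \<omega>)"] d0(1) by (simp add: norm_mult)
    then show "AE \<omega> in N. norm (complex_of_real (d n \<omega>) * b \<omega>) \<le> k * 2 * norm (b \<omega>)"
      by simp
  qed (use b q in simp_all)
  have \<epsilon>_lim: "\<epsilon> \<longlonglongrightarrow> 0"
    unfolding \<epsilon>_def
  proof (rule Lp_norm_dominated_convergence_zero[OF q])
    show "(\<lambda>\<omega>. complex_of_real (k * 2) * b \<omega>) \<in> Lp_space q N"
      by (rule Lp_space_scale[OF b])
    show "norm (complex_of_real (d n \<omega>) * b \<omega>) \<le> norm (complex_of_real (k * 2) * b \<omega>)" for n \<omega>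
      using mult_right_mono[OF d0(2), of "norm (b \<omega>)"] d0(1) k by (simp add: norm_mult)
    fix \<omega>
    have "(\<lambda>n. norm (a \<omega>) / real (Suc n)) \<longlonglongrightarrow> 0"
      using LIMSEQ_Suc[OF lim_const_over_n[of "norm (a \<omega>)"]] by simp
    then have "(\<lambda>n. complex_of_real (k * min 2 (norm (a \<omega>) / real (Suc n))) * b \<omega>)
        \<longlonglongrightarrow> complex_of_real (k * min 2 0) * b \<omega>"
      by (intro tendsto_intros)
    then show "(\<lambda>n. complex_of_real (d n \<omega>) * b \<omega>) \<longlonglongrightarrow> 0"
      by (simp add: d_def)
  qed measurable
  define B where "B = Lp_norm q N b"
  have B: "0 \<le> B" by (simp add: B_def)
  define L where "L = 2 * 2 powr (1 / q)"
  have L: "0 \<le> L" by (simp add: L_def)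
  \<comment> \<open>One bound for both errors in the definition: at a fixed s the weights \<alpha>,
    \<beta> are |u s| and |u s - U n s|, and for the integrals they are \<open>J\<close> and
    \<open>\<eta> n\<close>.\<close>
  have Lp_bound: "Lp_norm q N g \<le> L * (\<alpha> * \<epsilon> n + \<beta> * (k * B))"
    if [measurable]: "g \<in> borel_measurable N" and "0 \<le> \<alpha>" "0 \<le> \<beta>"
      and g: "AE \<omega> in N. norm (g \<omega>) \<le> (d n \<omega> * \<alpha> + k * \<beta>) * norm (b \<omega>)" for g n \<alpha> \<beta>
  proof -
    let ?b = "\<lambda>\<omega>. complex_of_real (norm (b \<omega>))"
    have bLp: "?b \<in> Lp_space q N"
      using b by (auto simp: Lp_space_def)
    have dLp: "(\<lambda>\<omega>. complex_of_real (d n \<omega>) * ?b \<omega>) \<in> Lp_space q N"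
      using dbLp[of n] by (auto simp: Lp_space_def norm_mult)
    have eqs: "Lp_norm q N ?b = B" "Lp_norm q N (\<lambda>\<omega>. complex_of_real (d n \<omega>) * ?b \<omega>) = \<epsilon> n"
      by (auto simp: B_def \<epsilon>_def Lp_norm_def norm_mult)
    let ?f = "\<lambda>\<omega>. complex_of_real \<alpha> * (complex_of_real (d n \<omega>) * ?b \<omega>)"
    let ?g = "\<lambda>\<omega>. complex_of_real (\<beta> * k) * ?b \<omega>"
    have "Lp_norm q N g \<le> Lp_norm q N (\<lambda>\<omega>. ?f \<omega> + ?g \<omega>)"
    proof (rule Lp_norm_mono)
      show "(\<lambda>\<omega>. ?f \<omega> + ?g \<omega>) \<in> Lp_space q N"
        using q by (intro Lp_space_add Lp_space_scale dLp bLp) auto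
      show "AE \<omega> in N. norm (g \<omega>) \<le> norm (?f \<omega> + ?g \<omega>)"
        using g
      proof eventually_elim
        case (elim \<omega>)
        have "?f \<omega> + ?g \<omega> = complex_of_real ((d n \<omega> * \<alpha> + k * \<beta>) * norm (b \<omega>))"
          by (simp add: algebra_simps)
        then show ?case
          using elim by (metis abs_ge_self norm_of_real order_trans)
      qed
    qed (use q in auto)
    also have "\<dots> \<le> L * (Lp_norm q N ?f + Lp_norm q N ?g)"
      unfolding L_def by (intro Lp_norm_quasi_triangle Lp_space_scale dLp bLp q)
    also have "Lp_norm q N ?f = \<alpha> * \<epsilon> n"
      using that q by (simp only: Lp_norm_scale eqs norm_of_real abs_of_nonneg)
    also have "Lp_norm q N ?g = \<beta> * k * B"
      using that q k by (simp only: Lp_norm_scale eqs norm_of_real abs_of_nonneg mult_nonneg_nonneg less_imp_le)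
    finally show ?thesis by (simp add: mult.assoc)
  qed
  let ?F = "\<lambda>s \<omega>. mult_semigroup a (t - s) b \<omega> * u s"
  have F_eq: "?F s = (\<lambda>\<omega>. exp (complex_of_real (t - s) * a \<omega>) * b \<omega> * u s)" for s
    by (simp add: mult_semigroup_def)
  have F_eq': "?F s \<omega> = b \<omega> * (exp (complex_of_real (t - s) * a \<omega>) * u s)" for s \<omega>
    by (simp add: mult_semigroup_def)
  have FS_eq: "?F s \<omega> - S n s \<omega> = (exp (complex_of_real (t - s) * a \<omega>) * u s
      - exp (complex_of_real (t - \<tau> n s) * a \<omega>) * U n s) * b \<omega>" for n s \<omega>
    by (simp add: S_def mult_semigroup_def algebra_simps)
  have FLp: "?F s \<in> Lp_space q N" if "s \<in> space (K t)" for s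
    unfolding F_eq using that by (intro TLp) (auto simp: spK)
  have SLp: "S n s \<in> Lp_space q N" if "s \<in> space (K t)" for n s
    unfolding S_def using that \<tau>[of s n] by (intro TLp) (auto simp: spK)
  have FS_le: "Lp_norm q N (\<lambda>\<omega>. ?F s \<omega> - S n s \<omega>)
      \<le> L * (norm (u s) * \<epsilon> n + norm (u s - U n s) * (k * B))" if s: "s \<in> space (K t)" for n s
  proof (rule Lp_bound)
    show "(\<lambda>\<omega>. ?F s \<omega> - S n s \<omega>) \<in> borel_measurable N"
      using Lp_space_diff[OF FLp[OF s] SLp[OF s]] q by (simp add: Lp_space_def)
    show "AE \<omega> in N. norm (?F s \<omega> - S n s \<omega>)
        \<le> (d n \<omega> * norm (u s) + k * norm (u s - U n s)) * norm (b \<omega>)"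
      using ac
    proof eventually_elim
      case (elim \<omega>)
      show ?case
        unfolding FS_eq norm_mult[of _ "b \<omega>"] using diff_le[OF elim s] by (rule mult_right_mono) simp
    qed
  qed auto
  have U_int: "integrable (K t) (U n)" for n
  proof (rule Bochner_Integration.integrable_bound)
    show "integrable (K t) (\<lambda>s. 2 * u s)" using u by simp
    show "AE s in K t. norm (U n s) \<le> norm (2 * u s)"
      using Ule by (auto simp: norm_mult)
  qed measurable
  define \<eta> where "\<eta> n = (LINT s|K t. norm (u s - U n s))" for n
  have \<eta>_lim: "\<eta> \<longlonglongrightarrow> 0"
  proof -
    have "(\<lambda>n. LINT s|K t. norm (u s - U n s)) \<longlonglongrightarrow> (LINT s|K t. 0)"
    proof (rule integral_dominated_convergence)
      \<comment> \<open>The factor 3 is 1 + 2, because |U n s| is at most 2|u s|.\<close>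
      show "integrable (K t) (\<lambda>s. 3 * norm (u s))" using u by simp
      show "AE s in K t. (\<lambda>n. norm (u s - U n s)) \<longlonglongrightarrow> 0"
      proof (rule AE_I2)
        fix s assume "s \<in> space (K t)"
        then have "(\<lambda>n. norm (u s - U n s)) \<longlonglongrightarrow> norm (u s - u s)"
          by (intro tendsto_intros Ulim)
        then show "(\<lambda>n. norm (u s - U n s)) \<longlonglongrightarrow> 0" by simp
      qed
      show "AE s in K t. norm (norm (u s - U n s)) \<le> 3 * norm (u s)" for n
      proof (rule AE_I2)
        fix s assume "s \<in> space (K t)"
        then show "norm (norm (u s - U n s)) \<le> 3 * norm (u s)"
          using Ule[of s n] norm_triangle_ineq4[of "u s" "U n s"] by simp
      qed
    qed measurable
    then show ?thesis by (simp add: \<eta>_def[abs_def])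
  qed
  define J where "J = (LINT s|K t. norm (u s))"
  have J: "0 \<le> J" "\<And>n. 0 \<le> \<eta> n" by (auto simp: J_def \<eta>_def)
  have bd_lim: "(\<lambda>n. L * (J * \<epsilon> n + \<eta> n * (k * B))) \<longlonglongrightarrow> 0"
    using tendsto_mult_left[OF tendsto_add[OF tendsto_mult_left[OF \<epsilon>_lim, of J]
      tendsto_mult_right[OF \<eta>_lim, of "k * B"]], of L] by simp
  have \<psi>_int: "integrable (K t) (\<lambda>s. exp (complex_of_real (t - s) * z) * u s)" for z
    using integrable_exp_mult u by (simp add: K_def)
  have xb: "x \<in> Lp_space q N"
  proof (rule Lp_spaceI_bounded[where C="k * J"])
    show "AE \<omega> in N. norm (x \<omega>) \<le> k * J * norm (b \<omega>)"
      using x_eq ac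
    proof eventually_elim
      case (elim \<omega>)
      have "norm (LINT s|K t. exp (complex_of_real (t - s) * a \<omega>) * u s)
          \<le> (LINT s|K t. norm (exp (complex_of_real (t - s) * a \<omega>) * u s))"
        by (rule integral_norm_bound)
      also have "\<dots> \<le> (LINT s|K t. k * norm (u s))"
      proof (rule integral_mono)
        show "norm (exp (complex_of_real (t - s) * a \<omega>) * u s) \<le> k * norm (u s)"
          if "s \<in> space (K t)" for s
          using exp_le[OF elim(2), of "t - s"] that
          by (auto simp: norm_mult spK intro!: mult_right_mono)
      qed (use \<psi>_int u in auto)
      also have "\<dots> = k * J" by (simp add: J_def)
      finally show ?case
        using elim(1) by (simp add: norm_mult mult.commute[of "norm (b \<omega>)"] mult_right_mono)
    qed
  qed (use x b q in auto)
  have SI: "has_bochner_integral (K t) (\<lambda>s. S n s \<omega>) (simple_Lp_integral (K t) (S n) \<omega>)" for n \<omega>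
    by (rule has_bochner_integral_simple_function[OF K.finite_measure_axioms S_simple])
  \<comment> \<open>The pointwise estimate \<open>diff_le\<close> is integrated over s at fixed
    \<omega>, and the norm in \<omega> is taken only afterwards. Since \<open>d n \<omega>\<close>
    is independent of s, integration just turns the weights into \<open>J\<close> and
    \<open>\<eta> n\<close>.\<close>
  have SI_le: "Lp_norm q N (\<lambda>\<omega>. simple_Lp_integral (K t) (S n) \<omega> - x \<omega>)
      \<le> L * (J * \<epsilon> n + \<eta> n * (k * B))" for n
  proof (rule Lp_bound)
    have "simple_Lp_integral (K t) (S n) \<in> Lp_space q N"
      unfolding simple_Lp_integral_def using q SLp
      by (intro Lp_space_sum Lp_space_scale) auto
    then show "(\<lambda>\<omega>. simple_Lp_integral (K t) (S n) \<omega> - x \<omega>) \<in> borel_measurable N"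
      by (auto simp: Lp_space_def)
    show "AE \<omega> in N. norm (simple_Lp_integral (K t) (S n) \<omega> - x \<omega>)
        \<le> (d n \<omega> * J + k * \<eta> n) * norm (b \<omega>)"
      using ac x_eq
    proof eventually_elim
      case (elim \<omega>)
      have Fi: "integrable (K t) (\<lambda>s. ?F s \<omega>)"
        unfolding F_eq' by (rule integrable_mult_right[OF \<psi>_int])
      have "x \<omega> = (LINT s|K t. ?F s \<omega>)"
        unfolding elim(2) F_eq' by (rule integral_mult_right_zero[symmetric])
      then have "simple_Lp_integral (K t) (S n) \<omega> - x \<omega> = - (LINT s|K t. ?F s \<omega> - S n s \<omega>)"
        using Fi SI[of n \<omega>] by (auto simp: has_bochner_integral_iff)
      then have "norm (simple_Lp_integral (K t) (S n) \<omega> - x \<omega>) = norm (LINT s|K t. ?F s \<omega> - S n s \<omega>)"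
        by (simp only: norm_minus_cancel)
      also have "\<dots> \<le> (LINT s|K t. norm (?F s \<omega> - S n s \<omega>))"
        by (rule integral_norm_bound)
      also have "\<dots> \<le> (LINT s|K t. (d n \<omega> * norm (u s) + k * norm (u s - U n s)) * norm (b \<omega>))"
      proof (rule integral_mono)
        show "integrable (K t) (\<lambda>s. norm (?F s \<omega> - S n s \<omega>))"
          using Fi SI[of n \<omega>] by (auto simp: has_bochner_integral_iff)
        show "integrable (K t) (\<lambda>s. (d n \<omega> * norm (u s) + k * norm (u s - U n s)) * norm (b \<omega>))"
          using u U_int[of n] by auto
        show "norm (?F s \<omega> - S n s \<omega>) \<le> (d n \<omega> * norm (u s) + k * norm (u s - U n s)) * norm (b \<omega>)"
          if s: "s \<in> space (K t)" for s
          unfolding FS_eq norm_mult[of _ "b \<omega>"] using diff_le[OF elim(1) s] by (rule mult_right_mono) simp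
      qed
      also have "\<dots> = (d n \<omega> * J + k * \<eta> n) * norm (b \<omega>)"
        using u U_int[of n] by (simp add: J_def \<eta>_def)
      finally show ?case .
    qed
  qed (use J in auto)
  show ?thesis
    unfolding has_Lp_bochner_integral_def
  proof (intro conjI exI[of _ S] ballI allI)
    show "simple_Lp_integrable q N (K t) (S n)" for n
      using S_simple SLp K.emeasure_finite by (auto simp: simple_Lp_integrable_def)
    show "AE s in K t. (\<lambda>n. Lp_norm q N (\<lambda>\<omega>. ?F s \<omega> - S n s \<omega>)) \<longlonglongrightarrow> 0"
    proof (rule AE_I2)
      fix s assume s: "s \<in> space (K t)"
      have "(\<lambda>n. L * (norm (u s) * \<epsilon> n + norm (u s - U n s) * (k * B)))
          \<longlonglongrightarrow> L * (norm (u s) * 0 + norm (u s - u s) * (k * B))"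
        by (intro tendsto_intros \<epsilon>_lim Ulim s)
      then have lim: "(\<lambda>n. L * (norm (u s) * \<epsilon> n + norm (u s - U n s) * (k * B))) \<longlonglongrightarrow> 0"
        by simp
      show "(\<lambda>n. Lp_norm q N (\<lambda>\<omega>. ?F s \<omega> - S n s \<omega>)) \<longlonglongrightarrow> 0"
        by (rule tendsto_sandwich[OF _ _ tendsto_const lim])
          (rule always_eventually, rule allI, rule Lp_norm_nonneg FS_le[OF s])+
    qed
    show "(\<lambda>n. \<integral>\<^sup>+ s. ennreal (Lp_norm q N (\<lambda>\<omega>. ?F s \<omega> - S n s \<omega>)) \<partial>K t) \<longlonglongrightarrow> 0"
    proof (rule tendsto_sandwich[OF _ _ tendsto_const])
      show "(\<lambda>n. ennreal (L * (J * \<epsilon> n + \<eta> n * (k * B)))) \<longlonglongrightarrow> 0"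
        using tendsto_ennrealI[OF bd_lim] by simp
      show "\<forall>\<^sub>F n in sequentially. (\<integral>\<^sup>+ s. ennreal (Lp_norm q N (\<lambda>\<omega>. ?F s \<omega> - S n s \<omega>)) \<partial>K t)
          \<le> ennreal (L * (J * \<epsilon> n + \<eta> n * (k * B)))"
      proof (rule always_eventually, rule allI)
        fix n
        let ?m = "\<lambda>s. L * (norm (u s) * \<epsilon> n + norm (u s - U n s) * (k * B))"
        have "(\<integral>\<^sup>+ s. ennreal (Lp_norm q N (\<lambda>\<omega>. ?F s \<omega> - S n s \<omega>)) \<partial>K t) \<le> (\<integral>\<^sup>+ s. ennreal (?m s) \<partial>K t)"
          by (intro nn_integral_mono ennreal_leI FS_le)
        also have "\<dots> = ennreal (LINT s|K t. ?m s)"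
        proof (rule nn_integral_eq_integral)
          show "integrable (K t) ?m"
            using u U_int[of n] by (intro integrable_mult_right integrable_add integrable_mult_left) auto
          show "AE s in K t. 0 \<le> ?m s"
            using L B k by (auto simp: \<epsilon>_def intro!: mult_nonneg_nonneg add_nonneg_nonneg)
        qed
        also have "(LINT s|K t. ?m s) = L * (J * \<epsilon> n + \<eta> n * (k * B))"
          using u U_int[of n] by (simp add: J_def \<eta>_def)
        finally show "(\<integral>\<^sup>+ s. ennreal (Lp_norm q N (\<lambda>\<omega>. ?F s \<omega> - S n s \<omega>)) \<partial>K t)
          \<le> ennreal (L * (J * \<epsilon> n + \<eta> n * (k * B)))" .
      qed
    qed auto
    show "(\<lambda>n. Lp_norm q N (\<lambda>\<omega>. simple_Lp_integral (K t) (S n) \<omega> - x \<omega>)) \<longlonglongrightarrow> 0"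
      by (rule tendsto_sandwich[OF _ _ tendsto_const bd_lim])
        (rule always_eventually, rule allI, rule Lp_norm_nonneg SI_le)+
  qed (use xb FLp in auto)
qed

section \<open>Time reflection, the Laplace transform and the push-forward measure\<close>

text \<open>The extension by zero lets one map serve both directions: it carries inputs on [0,t] to
  the half-line, and applied twice it returns the restriction to [0,t], extended by zero.\<close>

definition reflect :: "real \<Rightarrow> (real \<Rightarrow> complex) \<Rightarrow> real \<Rightarrow> complex" where
  "reflect t u s = (if s \<in> {0..t} then u (t - s) else 0)"

text \<open>Moving the restriction into an indicator yields functions on the whole line, where the
  affine change of variable applies.\<close>

lemma Lp_space_interval_iff:
  assumes "A \<in> sets borel"
  shows "u \<in> Lp_space p (restrict_space lborel A) \<longleftrightarrow>
    (\<lambda>s. indicator A s *\<^sub>R u s) \<in> borel_measurable borel \<and>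
    integrable lborel (\<lambda>s. indicator A s *\<^sub>R (norm (u s) powr p))"
  using assms by (simp add: Lp_space_def borel_measurable_restrict_space_iff integrable_restrict_space)

lemma
  fixes u :: "real \<Rightarrow> complex"
  shows reflect_in_Lp_space_iff:
      "reflect t u \<in> Lp_space p (restrict_space lborel {0..}) \<longleftrightarrow>
        u \<in> Lp_space p (restrict_space lborel {0..t})"
    and Lp_norm_reflect:
      "Lp_norm p (restrict_space lborel {0..}) (reflect t u) = Lp_norm p (restrict_space lborel {0..t}) u"
proof -
  let ?g = "\<lambda>s. indicator {0..t} s *\<^sub>R u s"
  let ?G = "\<lambda>s. indicator {0..t} s *\<^sub>R (norm (u s) powr p)"
  have g: "(\<lambda>s. indicator {0..} s *\<^sub>R reflect t u s) = (\<lambda>s. ?g (t + (- 1) * s))"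
    by (auto simp: fun_eq_iff reflect_def indicator_def)
  have G: "(\<lambda>s. indicator {0..} s *\<^sub>R (norm (reflect t u s) powr p)) = (\<lambda>s. ?G (t + (- 1) * s))"
    by (auto simp: fun_eq_iff reflect_def indicator_def)
  \<comment> \<open>Both directions compose with s \<mapsto> t - s, which is its own
    inverse.\<close>
  have "(\<lambda>s. ?g (t + (- 1) * s)) \<in> borel_measurable borel \<longleftrightarrow> ?g \<in> borel_measurable borel"
  proof
    assume "?g \<in> borel_measurable borel"
    then show "(\<lambda>s. ?g (t + (- 1) * s)) \<in> borel_measurable borel"
      by (rule measurable_compose[rotated]) measurable
  next
    assume "(\<lambda>s. ?g (t + (- 1) * s)) \<in> borel_measurable borel"
    then have "(\<lambda>s. ?g (t + (- 1) * (t + (- 1) * s))) \<in> borel_measurable borel"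
      by (rule measurable_compose[rotated]) measurable
    then show "?g \<in> borel_measurable borel" by simp
  qed
  then show "reflect t u \<in> Lp_space p (restrict_space lborel {0..}) \<longleftrightarrow>
      u \<in> Lp_space p (restrict_space lborel {0..t})"
    using lborel_integrable_real_affine_iff[of "-1" ?G t]
    by (simp only: Lp_space_interval_iff g G closed_atLeast closed_atLeastAtMost borel_closed)
  show "Lp_norm p (restrict_space lborel {0..}) (reflect t u) = Lp_norm p (restrict_space lborel {0..t}) u"
  proof -
    have "(LINT s|restrict_space lborel {0..}. norm (reflect t u s) powr p) = (LINT s|lborel. ?G (t + (- 1) * s))"
      by (subst integral_restrict_space) (simp_all only: G, simp)
    also have "\<dots> = (LINT s|lborel. ?G s)"
      using lborel_integral_real_affine[of "-1" ?G t] by simp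
    also have "\<dots> = (LINT s|restrict_space lborel {0..t}. norm (u s) powr p)"
      by (rule integral_restrict_space[symmetric]) simp
    finally show ?thesis by (simp only: Lp_norm_def)
  qed
qed

lemma laplace_reflect:
  "laplace (reflect t u) (- z) = (LINT s|restrict_space lborel {0..t}. exp (complex_of_real (t - s) * z) * u s)"
proof -
  let ?g = "\<lambda>s. indicator {0..t} s *\<^sub>R (exp (complex_of_real (t - s) * z) * u s)"
  have "(\<lambda>s. indicator {0..} s *\<^sub>R (exp (- (complex_of_real s * (- z))) * reflect t u s))
      = (\<lambda>s. ?g (t + (- 1) * s))"
    by (auto simp: fun_eq_iff reflect_def indicator_def)
  then show ?thesis
    using lborel_integral_real_affine[of "-1" ?g t]
    by (simp add: laplace_def set_lebesgue_integral_def integral_restrict_space)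
qed

lemma borel_measurable_laplace [measurable]:
  assumes "u \<in> borel_measurable (restrict_space lborel {0..})"
  shows "laplace u \<in> borel_measurable borel"
proof -
  have [measurable]: "(\<lambda>s. indicator {0..} s *\<^sub>R u s) \<in> borel_measurable borel"
    using assms by (simp add: borel_measurable_restrict_space_iff)
  have "laplace u = (\<lambda>z. LINT s|lborel. exp (- (complex_of_real s * z)) * (indicator {0..} s *\<^sub>R u s))"
    by (simp add: fun_eq_iff laplace_def set_lebesgue_integral_def)
  also have "\<dots> \<in> borel_measurable borel"
    by (rule lborel.borel_measurable_lebesgue_integral) measurable
  finally show ?thesis .
qed

text \<open>Equality is obtained at every z. Equality for Lebesgue-almost every z would say nothing
  about \<nu>, which may be concentrated on a Lebesgue null set.\<close>

lemma laplace_cong_AE: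
  assumes "u \<in> borel_measurable (restrict_space lborel {0..})"
    and "v \<in> borel_measurable (restrict_space lborel {0..})"
    and "AE s in restrict_space lborel {0..}. u s = v s"
  shows "laplace u = laplace v"
proof
  fix z
  have [measurable]: "(\<lambda>s. indicator {0..} s *\<^sub>R u s) \<in> borel_measurable borel"
      "(\<lambda>s. indicator {0..} s *\<^sub>R v s) \<in> borel_measurable borel"
    using assms(1,2) by (simp_all add: borel_measurable_restrict_space_iff)
  have "AE s in lborel. s \<in> {0..} \<longrightarrow> u s = v s"
    using assms(3) by (simp add: AE_restrict_space_iff)
  then have "(LINT s|lborel. exp (- (complex_of_real s * z)) * (indicator {0..} s *\<^sub>R u s))
      = (LINT s|lborel. exp (- (complex_of_real s * z)) * (indicator {0..} s *\<^sub>R v s))"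
    by (intro integral_cong_AE) (measurable, auto simp: indicator_def)
  then show "laplace u z = laplace v z"
    by (simp add: laplace_def set_lebesgue_integral_def)
qed

text \<open>The density |b|^q and the composed integrand |f(a)|^q merge into |b f(a)|^q. The map
  called \<open>a\<close> here is instantiated with -a when \<nu> is considered.\<close>

lemma
  fixes f :: "complex \<Rightarrow> complex"
  assumes [measurable]: "a \<in> borel_measurable M" "b \<in> borel_measurable M" "f \<in> borel_measurable borel"
  shows in_Lp_space_pushforward_iff:
      "f \<in> Lp_space q (distr (density M (\<lambda>\<omega>. ennreal (norm (b \<omega>) powr q))) borel a) \<longleftrightarrow>
        (\<lambda>\<omega>. b \<omega> * f (a \<omega>)) \<in> Lp_space q M"
    and Lp_norm_pushforward:
      "Lp_norm q (distr (density M (\<lambda>\<omega>. ennreal (norm (b \<omega>) powr q))) borel a) f =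
        Lp_norm q M (\<lambda>\<omega>. b \<omega> * f (a \<omega>))"
  by (simp_all add: Lp_space_def Lp_norm_def integrable_distr_eq integral_distr
      integrable_density integral_density norm_mult powr_mult)

section \<open>Null sets of the extrapolation measure and the value of the convolution\<close>

text \<open>Only surjectivity of r - a is used: (r - a) g vanishes wherever a = r, so it can equal
  the indicator of a set of finite measure only if a = r on a null part of that set. Countably many
  such sets cover the space.\<close>

lemma resolvent_set_AE_neq:
  assumes "sigma_finite_measure M" and a [measurable]: "a \<in> borel_measurable M"
    and r: "r \<in> mult_op_resolvent_set q M a"
  shows "AE \<omega> in M. a \<omega> \<noteq> r"
proof -
  interpret sigma_finite_measure M by fact
  obtain A :: "nat \<Rightarrow> 'a set" where A: "range A \<subseteq> sets M" "(\<Union>i. A i) = space M"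
    "\<And>i. emeasure M (A i) \<noteq> \<infinity>"
    using sigma_finite by blast
  have "AE \<omega> in M. \<omega> \<in> A i \<longrightarrow> a \<omega> \<noteq> r" for i
  proof -
    define f :: "'a \<Rightarrow> complex" where "f = indicator (A i)"
    have Ai: "A i \<in> sets M" using A(1) by auto
    have "(\<lambda>\<omega>. norm (f \<omega>) powr q) = indicator (A i)"
      by (auto simp: f_def indicator_def fun_eq_iff)
    then have "f \<in> Lp_space q M"
      using Ai A(3)[of i] by (auto simp: Lp_space_def f_def less_top[symmetric])
    then obtain g where "AE \<omega> in M. r * g \<omega> - mult_op a g \<omega> = f \<omega>"
      using r unfolding mult_op_resolvent_set_def by blast
    then show ?thesis
      by eventually_elim (auto simp: f_def mult_op_def)
  qed
  then have "AE \<omega> in M. \<forall>i. \<omega> \<in> A i \<longrightarrow> a \<omega> \<noteq> r"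
    by (subst AE_all_countable) blast
  then show ?thesis
    using AE_space by eventually_elim (use A(2) in blast)
qed

text \<open>The weight is zero only where a = r, which is a null set of \<open>M\<close>. This
  carries identities found in the extrapolation space back to L^q over \<open>M\<close>.\<close>

lemma AE_extrapolation_measure_iff:
  assumes "sigma_finite_measure M" "a \<in> borel_measurable M" "r \<in> mult_op_resolvent_set q M a"
  shows "(AE \<omega> in extrapolation_measure q M a r. P \<omega>) \<longleftrightarrow> (AE \<omega> in M. P \<omega>)"
proof -
  note [measurable] = assms(2)
  have "(AE \<omega> in extrapolation_measure q M a r. P \<omega>) \<longleftrightarrow>
      (AE \<omega> in M. 0 < ennreal (norm (r - a \<omega>) powr (- q)) \<longrightarrow> P \<omega>)"
    unfolding extrapolation_measure_def by (rule AE_density) measurable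
  also have "\<dots> \<longleftrightarrow> (AE \<omega> in M. P \<omega>)"
  proof
    assume "AE \<omega> in M. 0 < ennreal (norm (r - a \<omega>) powr (- q)) \<longrightarrow> P \<omega>"
    then show "AE \<omega> in M. P \<omega>"
      using resolvent_set_AE_neq[OF assms] by eventually_elim auto
  qed (auto elim: AE_mp)
  finally show ?thesis .
qed

text \<open>Pointwise |u| \<le> 1 + |u|^p, and constants are integrable over a finite
  measure.\<close>

lemma integrable_of_Lp_space:
  assumes "finite_measure K" "u \<in> Lp_space p K" "1 \<le> p"
  shows "integrable K u"
proof -
  interpret finite_measure K by fact
  show ?thesis
  proof (rule Bochner_Integration.integrable_bound)
    show "integrable K (\<lambda>s. 1 + norm (u s) powr p)"
      using assms(2) by (simp add: Lp_space_def)
    show "AE s in K. norm (u s) \<le> norm (1 + norm (u s) powr p)"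
    proof (rule AE_I2)
      fix s
      show "norm (u s) \<le> norm (1 + norm (u s) powr p)"
      proof (cases "norm (u s) \<le> 1")
        case False
        then have "norm (u s) powr 1 \<le> norm (u s) powr p"
          using assms(3) by (intro powr_mono) auto
        then show ?thesis using False by simp
      qed (auto intro: order_trans)
    qed
  qed (use assms(2) in \<open>simp add: Lp_space_def\<close>)
qed

text \<open>Left to right is uniqueness of the Bochner integral and serves the passage from
  admissibility to the transform; right to left is existence and serves the converse. Membership of
  \<open>x\<close> in the extrapolation space is part of what is proved, so only measurability is
  assumed of it.\<close>

lemma has_Lp_bochner_integral_extrapolation_iff:
  fixes a b :: "'a \<Rightarrow> complex"
  assumes q: "1 < q" and p: "1 \<le> p" and M: "sigma_finite_measure M"
    and a: "a \<in> borel_measurable M"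
    and ac: "AE \<omega> in M. Re (a \<omega>) \<le> c"
    and r: "r \<in> mult_op_resolvent_set q M a"
    and b: "b \<in> extrapolation_space q M a r"
    and t: "0 \<le> t" and u: "u \<in> Lp_space p (restrict_space lborel {0..t})"
    and x: "x \<in> borel_measurable M"
  shows "has_Lp_bochner_integral q (extrapolation_measure q M a r) (restrict_space lborel {0..t})
      (\<lambda>s \<omega>. mult_semigroup a (t - s) b \<omega> * u s) x \<longleftrightarrow>
    (AE \<omega> in M. x \<omega> = b \<omega> * laplace (reflect t u) (- a \<omega>))" (is "?L \<longleftrightarrow> ?R")
proof -
  interpret sigma_finite_measure M by fact
  define N where "N = extrapolation_measure q M a r"
  define K where "K = restrict_space lborel {0..t}"
  note AE_iff = AE_extrapolation_measure_iff[OF M a r, folded N_def]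
  have sets [measurable_cong]: "sets N = sets M"
    by (simp add: N_def extrapolation_measure_def)
  note [measurable] = a x
  have K: "finite_measure K"
    by (rule finite_measureI) (use t in \<open>auto simp: K_def space_restrict_space emeasure_restrict_space\<close>)
  \<comment> \<open>A finite-valued density preserves \<sigma>-finiteness, which the uniqueness
    argument needs for its positive weight and for Tonelli.\<close>
  have N: "sigma_finite_measure N"
    unfolding N_def extrapolation_measure_def by (subst sigma_finite_iff_density_finite) auto
  have ui: "integrable K u"
    using integrable_of_Lp_space[OF K] u p by (simp add: K_def)
  have bLp: "b \<in> Lp_space q N"
    using b by (simp add: extrapolation_space_def N_def)
  have [measurable]: "b \<in> borel_measurable N" "a \<in> borel_measurable N"
    using bLp by (simp add: Lp_space_def, measurable)
  have [measurable]: "u \<in> borel_measurable K"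
    using ui by auto
  have F_eq: "mult_semigroup a (t - s) b \<omega> * u s
      = b \<omega> * (exp (complex_of_real (t - s) * a \<omega>) * u s)" for s \<omega>
    by (simp add: mult_semigroup_def)
  have val: "b \<omega> * laplace (reflect t u) (- a \<omega>) = (LINT s|K. mult_semigroup a (t - s) b \<omega> * u s)" for \<omega>
    unfolding laplace_reflect F_eq K_def by (rule integral_mult_right_zero[symmetric])
  show ?thesis
  proof
    assume L: ?L
    have "AE \<omega> in N. x \<omega> = (LINT s|K. mult_semigroup a (t - s) b \<omega> * u s)"
    proof (rule has_Lp_bochner_integral_AE_eq[OF q N K])
      have [measurable]: "(\<lambda>s. t - s) \<in> borel_measurable K"
        unfolding K_def by (rule measurable_restrict_space1) simp
      show "(\<lambda>(\<omega>, s). mult_semigroup a (t - s) b \<omega> * u s) \<in> borel_measurable (N \<Otimes>\<^sub>M K)"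
        unfolding mult_semigroup_def by measurable
      show "integrable K (\<lambda>s. mult_semigroup a (t - s) b \<omega> * u s)" for \<omega>
        unfolding F_eq K_def by (intro integrable_mult_right integrable_exp_mult ui[unfolded K_def])
    qed (use L in \<open>simp add: N_def K_def\<close>)
    then show ?R by (simp add: AE_iff val)
  next
    assume R: ?R
    then have "AE \<omega> in N. x \<omega> = b \<omega> * (LINT s|K. exp (complex_of_real (t - s) * a \<omega>) * u s)"
      by (simp add: AE_iff laplace_reflect K_def)
    then show ?L
      using has_Lp_bochner_integral_mult_semigroup[of q t a N c b u x] q t ac bLp ui x
      by (simp add: AE_iff N_def[symmetric] K_def[symmetric] sets measurable_cong_sets[OF sets refl])
  qed
qed

section \<open>Transfer of the estimate between inputs on [0,t] and compactly supported inputs on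
  the half-line\<close>

lemma reflect_reflect_AE_eq:
  assumes "AE s in restrict_space lborel {0..}. R < s \<longrightarrow> u s = 0" and "R \<le> t"
  shows "AE s in restrict_space lborel {0..}. reflect t (reflect t u) s = u s"
proof -
  have "AE s in restrict_space lborel {0..}. 0 \<le> (s::real)"
    by (intro AE_I2) (auto simp: space_restrict_space)
  with assms(1) show ?thesis
    by eventually_elim (use assms(2) in \<open>auto simp: reflect_def\<close>)
qed

theorem lemma3p6:
  fixes q q' :: real
    and M :: "'a measure"
    and a b :: "'a \<Rightarrow> complex"
    and r :: complex
  assumes "1 < q" and "1 / q + 1 / q' = 1"
    and "sigma_finite_measure M"
    and "a \<in> borel_measurable M"
    and "\<exists>c::real. AE \<omega> in M. Re (a \<omega>) \<le> c"
    and "r \<in> mult_op_resolvent_set q M a"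
    and "b \<in> extrapolation_space q M a r"
  shows "infinite_time_admissible q' q M a r b \<longleftrightarrow>
    laplace_bounded q' q
      (distr (density M (\<lambda>\<omega>. ennreal (norm (b \<omega>) powr q))) borel (\<lambda>\<omega>. - a \<omega>))"
    (is "_ \<longleftrightarrow> laplace_bounded q' q ?\<nu>")
proof -
  obtain c where c: "AE \<omega> in M. Re (a \<omega>) \<le> c"
    using assms(5) by blast
  \<comment> \<open>The relation places 1/q' strictly between 0 and 1; this also excludes q' = 0,
    where 1/q' has the value 0.\<close>
  have q': "1 < q'"
  proof -
    have "0 < 1 / q" "1 / q < 1"
      using assms(1) by auto
    then have "0 < 1 / q'" "1 / q' < 1"
      using assms(2) by linarith+
    then show ?thesis by simp
  qed
  note [measurable] = assms(4)
  have [measurable]: "b \<in> borel_measurable M"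
    using assms(7) by (simp add: extrapolation_space_def extrapolation_measure_def Lp_space_def)
  let ?H = "restrict_space lborel {0::real..}"
  let ?K = "\<lambda>t. restrict_space lborel {0..t::real}"
  note bochner_iff = has_Lp_bochner_integral_extrapolation_iff[OF assms(1) less_imp_le[OF q'] assms(3,4) c assms(6,7)]
  note \<nu>_iff = in_Lp_space_pushforward_iff[of "\<lambda>\<omega>. - a \<omega>" M b] Lp_norm_pushforward[of "\<lambda>\<omega>. - a \<omega>" M b]
  show ?thesis
  proof
    assume "infinite_time_admissible q' q M a r b"
    then obtain C where C: "0 < C" and adm: "\<And>t u. 0 \<le> t \<Longrightarrow> u \<in> Lp_space q' (?K t) \<Longrightarrow>
        \<exists>x. has_Lp_bochner_integral q (extrapolation_measure q M a r) (?K t)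
              (\<lambda>s \<omega>. mult_semigroup a (t - s) b \<omega> * u s) x \<and>
            x \<in> Lp_space q M \<and> Lp_norm q M x \<le> C * Lp_norm q' (?K t) u"
      by (auto simp: infinite_time_admissible_def)
    show "laplace_bounded q' q ?\<nu>"
      unfolding laplace_bounded_def
    proof (intro exI[of _ C] conjI ballI impI C)
      fix u assume u: "u \<in> Lp_space q' ?H" and "\<exists>R. AE s in ?H. R < s \<longrightarrow> u s = 0"
      then obtain R where R: "AE s in ?H. R < s \<longrightarrow> u s = 0" by blast
      \<comment> \<open>The maximum is taken because the support bound R may be negative.\<close>
      define t where "t = max 0 R"
      \<comment> \<open>The input on [0,t] whose reflection is \<open>u\<close> up to a null set:
        beyond t the function \<open>u\<close> vanishes only almost everywhere, while
        \<open>reflect t w\<close> is exactly zero there.\<close>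
      define w where "w = reflect t u"
      have um: "u \<in> borel_measurable ?H"
        using u by (simp add: Lp_space_def)
      have wm: "reflect t w \<in> borel_measurable ?H"
      proof -
        have [measurable]: "(\<lambda>s. indicator {0..} s *\<^sub>R u s) \<in> borel_measurable borel"
          using um by (simp add: borel_measurable_restrict_space_iff)
        have "(\<lambda>s. indicator {0..t} s *\<^sub>R (indicator {0..} s *\<^sub>R u s)) \<in> borel_measurable borel"
          by (rule borel_measurable_scaleR) measurable
        also have "(\<lambda>s. indicator {0..t} s *\<^sub>R (indicator {0..} s *\<^sub>R u s))
            = (\<lambda>s. indicator {0..} s *\<^sub>R reflect t w s)"
          by (auto simp: fun_eq_iff w_def reflect_def indicator_def)
        finally show ?thesis
          by (simp add: borel_measurable_restrict_space_iff)
      qed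
      have eq: "AE s in ?H. reflect t w s = u s"
        unfolding w_def by (rule reflect_reflect_AE_eq[OF R]) (simp add: t_def)
      have "reflect t w \<in> Lp_space q' ?H"
        using Lp_space_cong_AE[OF wm um eq] u by simp
      then have w: "w \<in> Lp_space q' (?K t)"
        by (simp add: reflect_in_Lp_space_iff)
      have w_norm: "Lp_norm q' (?K t) w = Lp_norm q' ?H u"
        using Lp_norm_cong_AE[OF wm um eq] by (simp add: Lp_norm_reflect)
      have t: "0 \<le> t" by (simp add: t_def)
      obtain x where x: "has_Lp_bochner_integral q (extrapolation_measure q M a r) (?K t)
              (\<lambda>s \<omega>. mult_semigroup a (t - s) b \<omega> * w s) x"
            "x \<in> Lp_space q M" "Lp_norm q M x \<le> C * Lp_norm q' ?H u"
        using adm[OF t w] w_norm by auto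
      have xm: "x \<in> borel_measurable M"
        using x(2) by (simp add: Lp_space_def)
      have lm [measurable]: "laplace u \<in> borel_measurable borel"
        by (rule borel_measurable_laplace[OF um])
      have x_eq: "AE \<omega> in M. x \<omega> = b \<omega> * laplace u (- a \<omega>)"
        using x(1) bochner_iff[OF t w xm] laplace_cong_AE[OF wm um eq] by simp
      have m: "(\<lambda>\<omega>. b \<omega> * laplace u (- a \<omega>)) \<in> borel_measurable M"
        by measurable
      show "laplace u \<in> Lp_space q ?\<nu>"
        using Lp_space_cong_AE[OF xm m x_eq] x(2) by (simp add: \<nu>_iff)
      show "Lp_norm q ?\<nu> (laplace u) \<le> C * Lp_norm q' ?H u"
        using Lp_norm_cong_AE[OF xm m x_eq, of q] x(3) by (simp add: \<nu>_iff)
    qed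
  next
    assume "laplace_bounded q' q ?\<nu>"
    then obtain C where C: "0 < C" and bdd: "\<And>u R. u \<in> Lp_space q' ?H \<Longrightarrow>
        AE s in ?H. R < s \<longrightarrow> u s = 0 \<Longrightarrow>
        laplace u \<in> Lp_space q ?\<nu> \<and> Lp_norm q ?\<nu> (laplace u) \<le> C * Lp_norm q' ?H u"
      unfolding laplace_bounded_def by blast
    show "infinite_time_admissible q' q M a r b"
      unfolding infinite_time_admissible_def
    proof (intro exI[of _ C] conjI allI impI ballI C)
      fix t :: real and u assume t: "0 \<le> t" and u: "u \<in> Lp_space q' (?K t)"
      let ?v = "reflect t u"
      have v: "?v \<in> Lp_space q' ?H"
        using u by (simp add: reflect_in_Lp_space_iff)
      have [measurable]: "laplace ?v \<in> borel_measurable borel"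
        using v by (intro borel_measurable_laplace) (simp add: Lp_space_def)
      have bd: "laplace ?v \<in> Lp_space q ?\<nu>" "Lp_norm q ?\<nu> (laplace ?v) \<le> C * Lp_norm q' (?K t) u"
        \<comment> \<open>The support bound is R = t, since the reflection is zero beyond t by
          construction.\<close>
        using bdd[OF v, of t] by (auto simp: reflect_def Lp_norm_reflect)
      show "\<exists>x. has_Lp_bochner_integral q (extrapolation_measure q M a r) (?K t)
              (\<lambda>s \<omega>. mult_semigroup a (t - s) b \<omega> * u s) x \<and>
            x \<in> Lp_space q M \<and> Lp_norm q M x \<le> C * Lp_norm q' (?K t) u"
      proof (intro exI conjI)
        show "has_Lp_bochner_integral q (extrapolation_measure q M a r) (?K t)
              (\<lambda>s \<omega>. mult_semigroup a (t - s) b \<omega> * u s) (\<lambda>\<omega>. b \<omega> * laplace ?v (- a \<omega>))"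
          by (subst bochner_iff[OF t u]) auto
      qed (use bd in \<open>simp_all add: \<nu>_iff\<close>)
    qed
  qed
qed

end
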